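(* Let $\mathcal{H}$ be a set of ordered sets such that the duplications of the elements of $\mathcal{H}$ are representable. Then the elements of $\mathcal{S}(\mathcal{H})^\omega$ are also representable. Moreover, if the duplication of every representable ordered set is representable, then the elements of $\mathcal{S}(\mathcal{H})^*$ are also representable.
   Context: "Ordered set" means linearly ordered set. Two ordered sets are similar if there is an order preserving bijection between them. Real valued functions are partially ordered pointwise: $f\le g$ iff $f(x)\le g(x)$ for all $x$. An ordered set is representable if it is similar to a set of Baire 1 functions $\mathbb{R}\to\mathbb{R}$ that is linearly ordered by the pointwise ordering; an order type is representable if some (equivalently every) ordered set of that type is. The duplication of an ordered set $X$ is $X\times\{0,1\}$ with the lexicographical ordering. For an ordered set $X$ and an ordinal $\alpha$, $X^\alpha$ is the set of functions $\alpha\to X$ with the lexicographical ordering: $f<g$ iff for some $\beta<\alpha$ we have $f(\beta)<g(\beta)$ and $f(\gamma)=g(\gamma)$ for every $\gamma<\beta$. Replacing the points of an ordered set $X$ by ordered sets $Y_x$ $(x\in X)$ means forming $\{(x,y):x\in X,\ y\in Y_x\}$ with the lexicographical ordering. Given a set $\mathcal{H}$ of ordered sets, define a transfinite sequence $S_\alpha$ ($\alpha$ an ordinal): $S_0=\mathcal{H}\cup\{\emptyset\}$, and for $\alpha>0$, $S_\alpha$ is the set of ordered sets that can be obtained by replacing the points of some $X\in\bigcup_{\beta<\alpha}S_\beta$ by sets $Y_x\in\bigcup_{\beta<\alpha}S_\beta$ $(x\in X)$. $\mathcal{S}(\mathcal{H})$ denotes the set of order types of the elements of $\bigcup_{\alpha}S_\alpha$,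 the union being over all ordinals $\alpha$. For a set $\mathcal{G}$ of ordered sets (or order types), $\mathcal{G}^\omega=\{Y: Y\subset X^\omega,\ X\in\mathcal{G}\}$, and $\mathcal{G}^*$ is the closure of $\mathcal{G}$ under the operations $X\mapsto X^\alpha$ $(\alpha<\omega_1)$. $\mathcal{S}(\mathcal{H})^\omega$ and $\mathcal{S}(\mathcal{H})^*$ are these notions applied to $\mathcal{G}=\mathcal{S}(\mathcal{H})$. *)

theory Defs
  imports Complex_Main "HOL-Library.FuncSet"
begin

text \<open>
  An ordered set is a reflexive linear order relation \<open>r\<close> (\<open>Linear_order r\<close>) with carrier
  \<open>Field r\<close>. Because of reflexivity the empty relation is the empty ordered set and \<open>{(a, a)}\<close>
  the one-point ordered set on \<open>a\<close>.
\<close>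

definition similar :: "'a rel \<Rightarrow> 'b rel \<Rightarrow> bool" where
  "similar r s \<longleftrightarrow> (\<exists>f. bij_betw f (Field r) (Field s) \<and>
     (\<forall>x\<in>Field r. \<forall>y\<in>Field r. (x, y) \<in> r \<longleftrightarrow> (f x, f y) \<in> s))"

definition baire1 :: "(real \<Rightarrow> real) \<Rightarrow> bool" where
  "baire1 f \<longleftrightarrow> (\<exists>F :: nat \<Rightarrow> real \<Rightarrow> real. (\<forall>n. continuous_on UNIV (F n)) \<and>
     (\<forall>x. (\<lambda>n. F n x) \<longlonglongrightarrow> f x))"

definition representable :: "'a rel \<Rightarrow> bool" where
  "representable r \<longleftrightarrow> (\<exists>A :: (real \<Rightarrow> real) set.
     (\<forall>f\<in>A. baire1 f) \<and> (\<forall>f\<in>A. \<forall>g\<in>A. f \<le> g \<or> g \<le> f) \<and>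
     similar r {(f, g). f \<in> A \<and> g \<in> A \<and> f \<le> g})"

text \<open>Only the values of \<open>Y\<close> on \<open>Field X\<close> matter.\<close>

definition replace_points :: "'a rel \<Rightarrow> ('a \<Rightarrow> 'b rel) \<Rightarrow> ('a \<times> 'b) rel" where
  "replace_points X Y = {((x, y), (x', y')).
     x \<in> Field X \<and> x' \<in> Field X \<and> y \<in> Field (Y x) \<and> y' \<in> Field (Y x') \<and>
     (x \<noteq> x' \<and> (x, x') \<in> X \<or> x = x' \<and> (y, y') \<in> Y x)}"

definition duplication :: "'a rel \<Rightarrow> ('a \<times> nat) rel" where
  "duplication X = replace_points X (\<lambda>_. natLeq_on 2)"

lemma similar_trans:
  assumes "similar r s" "similar s t"
  shows "similar r t"
proof -
  obtain f where f: "bij_betw f (Field r) (Field s)"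
    "\<forall>x\<in>Field r. \<forall>y\<in>Field r. (x, y) \<in> r \<longleftrightarrow> (f x, f y) \<in> s"
    using assms(1) unfolding similar_def by blast
  obtain g where g: "bij_betw g (Field s) (Field t)"
    "\<forall>x\<in>Field s. \<forall>y\<in>Field s. (x, y) \<in> s \<longleftrightarrow> (g x, g y) \<in> t"
    using assms(2) unfolding similar_def by blast
  have "f x \<in> Field s" if "x \<in> Field r" for x using f(1) that by (rule bij_betwE[rule_format])
  thus ?thesis
    unfolding similar_def using bij_betw_trans[OF f(1) g(1)] f(2) g(2)
    by (intro exI[of _ "g \<circ> f"]) simp
qed

lemma Field_duplication: "Field (duplication X) = Field X \<times> {..<2}"
  unfolding duplication_def replace_points_def Field_natLeq_on
  by (fastforce simp: Field_def)

lemma similar_duplication: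
  assumes "similar r s"
  shows "similar (duplication r) (duplication s)"
proof -
  obtain f where f: "bij_betw f (Field r) (Field s)"
    "\<forall>x\<in>Field r. \<forall>y\<in>Field r. (x, y) \<in> r \<longleftrightarrow> (f x, f y) \<in> s"
    using assms(1) unfolding similar_def by blast
  have inj: "f x = f y \<longleftrightarrow> x = y" if "x \<in> Field r" "y \<in> Field r" for x y
    using f(1) that by (auto simp: bij_betw_def inj_on_def)
  have mem: "f x \<in> Field s" if "x \<in> Field r" for x
    using f(1) that by (rule bij_betwE[rule_format])
  have "bij_betw (map_prod f id) (Field r \<times> {..<2 :: nat}) (Field s \<times> {..<2})"
    by (intro bij_betw_map_prod f(1) bij_betw_id)
  thus ?thesis
    unfolding similar_def Field_duplication
    by (intro exI[of _ "map_prod f id"])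
      (auto simp: duplication_def replace_points_def Field_natLeq_on inj mem f(2))
qed

text \<open>
  Every representable ordered set is similar to one on the type \<open>real \<Rightarrow> real\<close>, so a statement about
  the duplications of all representable ordered sets need only quantify over that type.
\<close>

lemma representable_duplication_all_types:
  fixes r :: "'a rel"
  assumes "\<forall>Z :: (real \<Rightarrow> real) rel. representable Z \<longrightarrow> representable (duplication Z)"
    and "representable r"
  shows "representable (duplication r)"
proof -
  obtain A :: "(real \<Rightarrow> real) set" where A: "\<forall>f\<in>A. baire1 f"
      "\<forall>f\<in>A. \<forall>g\<in>A. f \<le> g \<or> g \<le> f" "similar r {(f, g). f \<in> A \<and> g \<in> A \<and> f \<le> g}"
    using assms(2) unfolding representable_def by blast
  let ?Z = "{(f, g). f \<in> A \<and> g \<in> A \<and> f \<le> g}"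
  have "similar ?Z ?Z" unfolding similar_def by (intro exI[of _ id]) simp
  hence "representable ?Z" using A(1,2) unfolding representable_def by blast
  hence "representable (duplication ?Z)" using assms(1) by blast
  thus ?thesis
    using similar_trans[OF similar_duplication[OF A(3)]] unfolding representable_def by blast
qed

text \<open>
  The power \<open>X\<^sup>\<alpha>\<close>, the ordinal \<open>\<alpha>\<close> being given by a well-order \<open>a\<close>. The functions are
  extensional, that is, equal to \<open>undefined\<close> outside \<open>Field a\<close>.
\<close>

definition lex_power :: "'a rel \<Rightarrow> 'i rel \<Rightarrow> ('i \<Rightarrow> 'a) rel" where
  "lex_power X a = {(f, g).
     f \<in> Field a \<rightarrow>\<^sub>E Field X \<and> g \<in> Field a \<rightarrow>\<^sub>E Field X \<and>
     (f = g \<or> (\<exists>i\<in>Field a. f i \<noteq> g i \<and> (f i, g i) \<in> X \<and> (\<forall>j\<in>underS a i. f j = g j)))}"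

text \<open>
  Iterated replacement leads to carriers consisting of nested pairs, so we work in the type of
  all nested pairs over the type \<open>'a\<close> of the points of the members of \<open>H\<close>. Having all members
  of \<open>H\<close> live on one type is no restriction, since \<open>H\<close> is a set.
\<close>

datatype 'a nested = Point 'a | Nest "'a nested" "'a nested"

text \<open>
  \<open>S_stage H w i\<close> is \<open>S\<^sub>\<alpha>\<close> where \<open>\<alpha>\<close> is the order type of the set \<open>underS w i\<close> of the
  \<open>w\<close>-predecessors of \<open>i\<close>; in particular \<open>\<alpha> = 0\<close> iff \<open>underS w i\<close> is empty.
\<close>

definition S_stage :: "'a rel set \<Rightarrow> 'o rel \<Rightarrow> 'o \<Rightarrow> 'a nested rel set" where
  "S_stage H w = wfrec (w - Id) (\<lambda>S i.
     if underS w i = {} then (\<lambda>X. dir_image X Point) ` H \<union> {{}}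
     else {dir_image (replace_points X Y) (\<lambda>(x, y). Nest x y) | X Y.
             X \<in> (\<Union>j\<in>underS w i. S j) \<and>
             (\<forall>x\<in>Field X. Y x \<in> (\<Union>j\<in>underS w i. S j))})"

lemma S_stage_rec:
  assumes "Well_order w"
  shows "S_stage H w i =
    (if underS w i = {} then (\<lambda>X. dir_image X Point) ` H \<union> {{}}
     else {dir_image (replace_points X Y) (\<lambda>(x, y). Nest x y) | X Y.
             X \<in> (\<Union>j\<in>underS w i. S_stage H w j) \<and>
             (\<forall>x\<in>Field X. Y x \<in> (\<Union>j\<in>underS w i. S_stage H w j))})"
proof -
  have wf: "wf (w - Id)"
    using assms by (simp add: well_order_on_def)
  have cut: "(\<Union>j\<in>underS w i. cut (S_stage H w) (w - Id) i j) = (\<Union>j\<in>underS w i. S_stage H w j)"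
    by (auto simp: cut_def underS_def)
  show ?thesis
    unfolding S_stage_def wfrec[OF wf, of _ i]
    unfolding S_stage_def[symmetric] cut ..
qed

text \<open>
  The union of all \<open>S\<^sub>\<alpha>\<close>. HOL cannot quantify over the well-orders of all types at once;
  lemma \<open>S_stage_subset_S_union\<close> below shows that nothing is lost by
  letting the ordinals range over the well-orders on the type \<open>'a nested set\<close>.
\<close>

definition S_union :: "'a rel set \<Rightarrow> 'a nested rel set" where
  "S_union H = \<Union>{S_stage H w i | (w :: 'a nested set rel) i. Well_order w \<and> i \<in> Field w}"

lemma infinite_nested: "infinite (UNIV :: 'a nested set)"
proof
  assume fin: "finite (UNIV :: 'a nested set)"
  let ?f = "\<lambda>x :: 'a nested. Nest x x"
  have "inj ?f" by (auto intro: injI)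
  hence "surj ?f" using fin by (rule finite_UNIV_inj_surj[rotated])
  then obtain x where "Point undefined = ?f x" by (meson surjD)
  thus False by simp
qed

lemma S_stage_subset_S_union:
  fixes w :: "'o rel" and H :: "'a rel set"
  assumes w: "Well_order w" and i: "i \<in> Field w"
  shows "S_stage H w i \<subseteq> S_union H"
proof -
  let ?c = "card_of (UNIV :: 'a nested set)"
  define K where "K = cardSuc ?c"
  have cK: "Card_order K" unfolding K_def by (rule cardSuc_Card_order[OF card_of_Card_order])
  have wK: "Well_order K" unfolding K_def by (rule cardSuc_Well_order[OF card_of_Card_order])
  have infK: "infinite (Field K)"
    unfolding K_def by (simp add: cardSuc_finite[OF card_of_Card_order] infinite_nested Field_card_of)
  interpret K: wo_rel K using wK by (simp add: wo_rel_def)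
  define U where "U = (\<Union>k\<in>Field K. S_stage H K k)"
  have sub: "U \<subseteq> S_union H" unfolding U_def S_union_def using wK by blast
  have closed: "dir_image (replace_points X Y) (\<lambda>(x, y). Nest x y) \<in> U"
    if X: "X \<in> U" and Y: "\<And>x. x \<in> Field X \<Longrightarrow> Y x \<in> U" for X Y
  proof -
    define As where "As k = {x \<in> Field X. \<exists>j. (j, k) \<in> K \<and> Y x \<in> S_stage H K j}" for k
    have chain: "relChain K As"
      unfolding relChain_def As_def using K.TRANS by (blast dest: transD)
    have "Field X \<subseteq> (\<Union>k\<in>Field K. As k)"
    proof
      fix x assume x: "x \<in> Field X"
      then obtain k where k: "k \<in> Field K" "Y x \<in> S_stage H K k" using Y U_def by blast
      moreover have "(k, k) \<in> K" using K.REFL k(1) by (simp add: refl_on_def)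
      ultimately show "x \<in> (\<Union>k\<in>Field K. As k)" using x unfolding As_def by blast
    qed
    hence "\<exists>k\<in>Field K. Field X \<subseteq> As k"
      using chain unfolding K_def
      by (intro cardSuc_UNION[OF card_of_Card_order])
        (auto simp: infinite_nested Field_card_of intro: card_of_mono1)
    then obtain k where k: "k \<in> Field K" "Field X \<subseteq> As k" by blast
    obtain l where l: "l \<in> Field K" "X \<in> S_stage H K l" using X U_def by blast
    obtain m where m: "m \<in> Field K" "(k, m) \<in> K" "(l, m) \<in> K"
      using k(1) l(1) K.TOTAL K.REFL unfolding total_on_def refl_on_def by metis
    obtain n where n: "n \<in> Field K" "m \<noteq> n" "(m, n) \<in> K"
      using infinite_Card_order_limit[OF cK infK m(1)] by blast
    have lt: "j \<in> underS K n" if "(j, m) \<in> K" for j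
      using that n K.TRANS K.ANTISYM unfolding underS_def
      by (auto dest: transD antisymD)
    have 1: "X \<in> (\<Union>j\<in>underS K n. S_stage H K j)" using lt[OF m(3)] l(2) by blast
    have 2: "\<forall>x\<in>Field X. Y x \<in> (\<Union>j\<in>underS K n. S_stage H K j)"
    proof
      fix x assume "x \<in> Field X"
      then obtain j where j: "(j, k) \<in> K" "Y x \<in> S_stage H K j" using k(2) As_def by blast
      have "(j, m) \<in> K" using j(1) m(2) K.TRANS by (blast dest: transD)
      thus "Y x \<in> (\<Union>j\<in>underS K n. S_stage H K j)" using lt j(2) by blast
    qed
    have "underS K n \<noteq> {}" using lt[OF m(2)] by blast
    hence "dir_image (replace_points X Y) (\<lambda>(x, y). Nest x y) \<in> S_stage H K n"
      using 1 2 by (subst S_stage_rec[OF wK]) auto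
    thus ?thesis using n(1) unfolding U_def by blast
  qed
  have base: "(\<lambda>X. dir_image X Point) ` H \<union> {{}} \<subseteq> U"
  proof -
    have ne: "Field K \<noteq> {}" using infK by auto
    define z where "z = K.minim (Field K)"
    have z: "z \<in> Field K" unfolding z_def using ne by (simp add: K.minim_in)
    have "underS K z = {}"
    proof (rule ccontr)
      assume "underS K z \<noteq> {}"
      then obtain j where j: "j \<noteq> z" "(j, z) \<in> K" by (auto simp: underS_def)
      hence "j \<in> Field K" by (auto simp: Field_def)
      hence "(z, j) \<in> K" unfolding z_def by (simp add: K.minim_least)
      thus False using j K.ANTISYM by (auto dest: antisymD)
    qed
    hence "S_stage H K z = (\<lambda>X. dir_image X Point) ` H \<union> {{}}"
      by (subst S_stage_rec[OF wK]) simp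
    thus ?thesis using z unfolding U_def by blast
  qed
  have "S_stage H w i \<subseteq> U" for i
  proof -
    have "wf (w - Id)" using w by (simp add: well_order_on_def)
    thus ?thesis
    proof (induction i rule: wf_induct_rule)
      case (less i)
      hence IH: "S_stage H w j \<subseteq> U" if "j \<in> underS w i" for j
        using that by (auto simp: underS_def)
      show ?case
      proof (cases "underS w i = {}")
        case True
        thus ?thesis using base by (subst S_stage_rec[OF w]) simp
      next
        case False
        show ?thesis
        proof
          fix Z assume "Z \<in> S_stage H w i"
          then obtain X Y where Z: "Z = dir_image (replace_points X Y) (\<lambda>(x, y). Nest x y)"
            and X: "X \<in> (\<Union>j\<in>underS w i. S_stage H w j)"
            and Y: "\<forall>x\<in>Field X. Y x \<in> (\<Union>j\<in>underS w i. S_stage H w j)"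
            using False by (subst (asm) S_stage_rec[OF w]) auto
          have "X \<in> U" using X IH by blast
          moreover have "Y x \<in> U" if "x \<in> Field X" for x using Y that IH by blast
          ultimately show "Z \<in> U" unfolding Z by (rule closed)
        qed
      qed
    qed
  qed
  thus ?thesis using sub by blast
qed

text \<open>
  A set of order types is represented, on any type \<open>'b\<close>, by the set of all ordered sets on \<open>'b\<close>
  having one of these order types. This is the set of order types \<open>S(H)\<close>.
\<close>

definition S_types :: "'a rel set \<Rightarrow> 'b rel set" where
  "S_types H = {X. \<exists>Z\<in>S_union H. similar X Z}"

definition omega_class :: "'b rel set \<Rightarrow> (nat \<Rightarrow> 'b) rel set" where
  "omega_class G = {Restr (lex_power X natLeq) Y | X Y.
     X \<in> G \<and> Y \<subseteq> Field (lex_power X natLeq)}"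

text \<open>
  Iterating \<open>X \<mapsto> X\<^sup>\<alpha>\<close> leads to carriers consisting of nested countable sequences. The ordinals
  \<open>\<alpha> < \<omega>\<^sub>1\<close> are the order types of the well-orders of sets of natural numbers.
\<close>

datatype 'b nested_seq = Elem 'b | Seq "nat \<Rightarrow> 'b nested_seq"

inductive_set star_class :: "'b rel set \<Rightarrow> 'b nested_seq rel set" for G :: "'b rel set" where
  base: "X \<in> G \<Longrightarrow> dir_image X Elem \<in> star_class G"
| power: "X \<in> star_class G \<Longrightarrow> Well_order (a :: nat rel) \<Longrightarrow>
    dir_image (lex_power X a) Seq \<in> star_class G"

end

theory Submission
  imports Defs "HOL-Analysis.Uniform_Limit" "HOL-Library.Nat_Bijection"
begin

text \<open>
  If the duplication of \<open>X\<close> is representable, then, after composing with an increasing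
  homeomorphism onto an interval, every \<open>x \<in> X\<close> comes with a pair of Baire 1 functions
  \<open>f\<^sub>x < g\<^sub>x\<close> with values in \<open>[0, 1/2]\<close>, and \<open>g\<^sub>x < f\<^sub>y\<close> whenever \<open>x < y\<close>. The idea is to nest
  such pairs: to a sequence \<open>x\<^sub>0, x\<^sub>1, \<dots>\<close> belongs the function of infinitely many real variables
  whose value at \<open>(t\<^sub>0, t\<^sub>1, \<dots>)\<close> is obtained by descending into \<open>[f\<^bsub>x\<^sub>0\<^esub>(t\<^sub>0), g\<^bsub>x\<^sub>0\<^esub>(t\<^sub>0)]\<close>, into the
  subinterval of it with relative endpoints \<open>f\<^bsub>x\<^sub>1\<^esub>(t\<^sub>1), g\<^bsub>x\<^sub>1\<^esub>(t\<^sub>1)\<close>, and so on. The lengths at least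
  halve at every step, so this is a uniformly convergent series of Baire 1 functions
  (\<open>nested_sum\<close>). If \<open>x\<close> and \<open>y\<close> first differ at \<open>n\<close>, with \<open>x\<^sub>n < y\<^sub>n\<close>, then the function of
  \<open>x\<close> is below that of \<open>y\<close>, strictly so where the first \<open>n\<close> intervals are nondegenerate and
  \<open>g\<^bsub>x\<^sub>n\<^esub>(t\<^sub>n) < f\<^bsub>y\<^sub>n\<^esub>(t\<^sub>n)\<close>; such \<open>t\<^sub>0, \<dots>, t\<^sub>n\<close> exist since the variables are independent. To obtain
  functions of one real variable, substitute continuous coordinates \<open>\<pi>\<^sub>n(s)\<close> that attain all finite
  tuples simultaneously (\<open>coordinates_exist\<close>, built from Schoenberg's space-filling curve).
  The result is \<open>nesting_exists\<close>.

  Three applications follow. With \<open>x \<in> X\<close>, \<open>y \<in> Y\<^sub>x\<close> and \<open>e \<in> {0, 1}\<close> as the first three entries,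
  it shows that replacement of points preserves representability of the duplication
  (\<open>bracketed_replace_points\<close>), so every element of \<open>S(H)\<close> has a representable
  duplication. With the entries of \<open>f \<in> X\<^sup>\<omega>\<close>, it represents \<open>X\<^sup>\<omega>\<close>. Finally, if a countable
  ordinal \<open>\<alpha>\<close> is cut into consecutive blocks \<open>B\<^sub>0, B\<^sub>1, \<dots>\<close> and the duplications of the powers
  \<open>X\<^bsup>B\<^sub>n\<^esup>\<close> are representable, it represents \<open>X\<^sup>\<alpha>\<close> by the restrictions of \<open>f \<in> X\<^sup>\<alpha>\<close> to the blocks
  (\<open>representable_lex_power_blocks\<close>). As blocks that are singletons or bounded subsets always
  suffice, transfinite induction covers all countable powers once duplication preserves
  representability.
\<close>

section \<open>Baire 1 functions\<close>

lemma continuous_on_suminf: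
  fixes f :: "nat \<Rightarrow> real \<Rightarrow> real"
  assumes cont: "\<And>n. continuous_on UNIV (f n)"
    and bound: "\<And>n x. \<bar>f n x\<bar> \<le> M n" and "summable M"
  shows "continuous_on UNIV (\<lambda>x. \<Sum>n. f n x)"
proof (rule uniform_limit_theorem)
  show "uniform_limit UNIV (\<lambda>n x. \<Sum>i<n. f i x) (\<lambda>x. \<Sum>n. f n x) sequentially"
    using bound \<open>summable M\<close> by (intro Weierstrass_m_test) auto
  show "\<forall>\<^sub>F n in sequentially. continuous_on UNIV (\<lambda>x. \<Sum>i<n. f i x)"
    by (intro always_eventually allI continuous_on_sum cont)
qed simp

lemma baire1_continuous: "continuous_on UNIV f \<Longrightarrow> baire1 f"
  unfolding baire1_def by (intro exI[of _ "\<lambda>_. f"]) auto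

lemma baire1_diff:
  assumes "baire1 f" "baire1 g"
  shows "baire1 (\<lambda>x. f x - g x)"
proof -
  obtain F G where "\<And>n. continuous_on UNIV (F n)" "\<And>x. (\<lambda>n. F n x) \<longlonglongrightarrow> f x"
    "\<And>n. continuous_on UNIV (G n)" "\<And>x. (\<lambda>n. G n x) \<longlonglongrightarrow> g x"
    using assms unfolding baire1_def by blast
  thus ?thesis unfolding baire1_def
    by (intro exI[of _ "\<lambda>n x. F n x - G n x"]) (auto intro: continuous_on_diff tendsto_diff)
qed

lemma baire1_mult:
  assumes "baire1 f" "baire1 g"
  shows "baire1 (\<lambda>x. f x * g x)"
proof -
  obtain F G where "\<And>n. continuous_on UNIV (F n)" "\<And>x. (\<lambda>n. F n x) \<longlonglongrightarrow> f x"
    "\<And>n. continuous_on UNIV (G n)" "\<And>x. (\<lambda>n. G n x) \<longlonglongrightarrow> g x"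
    using assms unfolding baire1_def by blast
  thus ?thesis unfolding baire1_def
    by (intro exI[of _ "\<lambda>n x. F n x * G n x"]) (auto intro: continuous_on_mult tendsto_mult)
qed

lemma baire1_prod:
  fixes f :: "nat \<Rightarrow> real \<Rightarrow> real"
  assumes "\<And>k. baire1 (f k)"
  shows "baire1 (\<lambda>x. \<Prod>k<n. f k x)"
proof (induction n)
  case 0
  show ?case by (simp add: baire1_continuous)
next
  case (Suc n)
  thus ?case using baire1_mult[OF Suc.IH assms[of n]] by simp
qed

lemma baire1_compose_inner:
  assumes "baire1 f" "continuous_on UNIV g"
  shows "baire1 (\<lambda>x. f (g x))"
proof -
  obtain F where "\<And>n. continuous_on UNIV (F n)" "\<And>x. (\<lambda>n. F n x) \<longlonglongrightarrow> f x"
    using assms unfolding baire1_def by blast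
  thus ?thesis unfolding baire1_def
    by (intro exI[of _ "\<lambda>n x. F n (g x)"]) (auto intro: continuous_on_compose2 assms(2))
qed

lemma baire1_compose_outer:
  assumes "baire1 f" and g: "continuous_on UNIV g"
  shows "baire1 (\<lambda>x. g (f x))"
proof -
  obtain F where F: "\<And>n. continuous_on UNIV (F n)" "\<And>x. (\<lambda>n. F n x) \<longlonglongrightarrow> f x"
    using assms unfolding baire1_def by blast
  have "continuous_on UNIV (\<lambda>x. g (F n x))" for n
    using continuous_on_compose2[OF g F(1)[of n]] by simp
  moreover have "(\<lambda>n. g (F n x)) \<longlonglongrightarrow> g (f x)" for x
    by (rule continuous_on_tendsto_compose[OF g F(2)]) auto
  ultimately show ?thesis unfolding baire1_def
    by (intro exI[of _ "\<lambda>n x. g (F n x)"]) auto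
qed

lemma baire1_suminf:
  fixes f :: "nat \<Rightarrow> real \<Rightarrow> real"
  assumes baire: "\<And>n. baire1 (f n)"
    and bound: "\<And>n x. \<bar>f n x\<bar> \<le> M n" and M: "summable M"
  shows "baire1 (\<lambda>x. \<Sum>n. f n x)"
proof -
  obtain F where F: "\<And>n m. continuous_on UNIV (F n m)" "\<And>n x. (\<lambda>m. F n m x) \<longlonglongrightarrow> f n x"
    using baire unfolding baire1_def by metis
  \<comment> \<open>Clipping the approximants to the bounds of the terms makes dominated convergence available.\<close>
  define G where "G n m x = max (- M n) (min (M n) (F n m x))" for n m x
  have M0: "M n \<ge> 0" for n using bound[of n 0] by linarith
  have G_bound: "\<bar>G n m x\<bar> \<le> M n" for n m x
    unfolding G_def using M0[of n] by auto
  have "(\<lambda>m. G n m x) \<longlonglongrightarrow> max (- M n) (min (M n) (f n x))" for n x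
    unfolding G_def by (intro tendsto_intros F)
  moreover have "max (- M n) (min (M n) (f n x)) = f n x" for n x
    using bound[of n x] by auto
  ultimately have G_lim: "(\<lambda>m. G n m x) \<longlonglongrightarrow> f n x" for n x by simp
  have "continuous_on UNIV (G n m)" for n m
    unfolding G_def by (intro continuous_intros F)
  hence "continuous_on UNIV (\<lambda>x. \<Sum>n. G n m x)" for m
    using G_bound M by (rule continuous_on_suminf)
  moreover have "(\<lambda>m. \<Sum>n. G n m x) \<longlonglongrightarrow> (\<Sum>n. f n x)" for x
  proof -
    have "\<forall>\<^sub>F (n, m) in sequentially \<times>\<^sub>F sequentially. norm (G n m x) \<le> M n"
      by (rule always_eventually) (simp add: G_bound split: prod.split)
    thus ?thesis
      using tannerys_theorem[of "\<lambda>n m. G n m x" "\<lambda>n. f n x" sequentially M] G_lim M by simp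
  qed
  ultimately show ?thesis unfolding baire1_def
    by (intro exI[of _ "\<lambda>m x. \<Sum>n. G n m x"]) auto
qed

section \<open>Continuous coordinates on the real line\<close>

text \<open>The triangular wave of period 2 that is the identity on \<open>[0, 1]\<close>.\<close>

definition wave :: "real \<Rightarrow> real" where
  "wave s = arccos (cos (pi * s)) / pi"

text \<open>The wave stretched to vanish on \<open>[0, 1/3]\<close> and to be 1 on \<open>[2/3, 1]\<close>, so that
  it reads off the first ternary digit, halved, of the points of the Cantor set.\<close>

definition plateau :: "real \<Rightarrow> real" where
  "plateau s = max 0 (min 1 (3 * wave s - 1))"

lemma wave_id: "0 \<le> s \<Longrightarrow> s \<le> 1 \<Longrightarrow> wave s = s"
  unfolding wave_def by (simp add: arccos_cos)

lemma wave_periodic: "wave (s + 2 * real m) = wave s"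
proof -
  have "cos (pi * (s + 2 * real m)) = cos (pi * s + 2 * pi * real m)"
    by (simp add: algebra_simps)
  also have "\<dots> = cos (pi * s)"
    unfolding cos_add mult.assoc using cos_2npi[of m] sin_2npi[of m] by (simp add: mult_ac)
  finally show ?thesis unfolding wave_def by simp
qed

lemma plateau_periodic: "plateau (s + 2 * real m) = plateau s"
  unfolding plateau_def wave_periodic ..

lemma continuous_on_wave: "continuous_on UNIV wave"
  unfolding wave_def by (intro continuous_intros) auto

lemma continuous_on_plateau: "continuous_on UNIV plateau"
  unfolding plateau_def by (intro continuous_intros continuous_on_wave)

lemma plateau_bounds: "0 \<le> plateau s" "plateau s \<le> 1"
  unfolding plateau_def by auto

text \<open>The point of the Cantor set with ternary digits \<open>2 b\<^sub>0, 2 b\<^sub>1, \<dots>\<close>.\<close>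

definition cantor_point :: "(nat \<Rightarrow> nat) \<Rightarrow> real" where
  "cantor_point b = (\<Sum>j. 2 * real (b j) / 3 ^ Suc j)"

lemma sums_third: "(\<lambda>j. 2 / 3 ^ Suc j :: real) sums 1"
proof -
  have "(\<lambda>j. (2/3) * (1/3) ^ j :: real) sums ((2/3) * (1 / (1 - 1/3)))"
    by (intro sums_mult geometric_sums) simp
  thus ?thesis by (simp add: power_divide)
qed

lemma cantor_point_summable:
  assumes "\<And>j. b j \<le> 1"
  shows "summable (\<lambda>j. 2 * real (b j) / 3 ^ Suc j)"
  by (rule summable_comparison_test'[OF sums_summable[OF sums_third], of 0])
    (use assms in \<open>auto simp: divide_simps\<close>)

lemma cantor_point_bounds:
  assumes "\<And>j. b j \<le> 1"
  shows "0 \<le> cantor_point b" "cantor_point b \<le> 1"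
proof -
  note S = cantor_point_summable[of b, OF assms]
  show "0 \<le> cantor_point b" unfolding cantor_point_def by (rule suminf_nonneg[OF S]) simp
  have "cantor_point b \<le> (\<Sum>j. 2 / 3 ^ Suc j)"
    unfolding cantor_point_def
    by (rule suminf_le[OF _ S sums_summable[OF sums_third]])
      (use assms in \<open>auto simp: divide_simps\<close>)
  thus "cantor_point b \<le> 1" using sums_unique[OF sums_third] by simp
qed

lemma cantor_point_shift:
  assumes "\<And>j. b j \<le> 1"
  shows "3 * cantor_point b = 2 * real (b 0) + cantor_point (\<lambda>j. b (Suc j))"
proof -
  note S = cantor_point_summable[of b, OF assms]
  have "cantor_point b = 2 * real (b 0) / 3 + (\<Sum>j. 2 * real (b (Suc j)) / 3 ^ Suc (Suc j))"
    unfolding cantor_point_def using suminf_split_head[OF S] by simp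
  also have "(\<Sum>j. 2 * real (b (Suc j)) / 3 ^ Suc (Suc j)) = cantor_point (\<lambda>j. b (Suc j)) / 3"
    unfolding cantor_point_def
    using suminf_divide[OF cantor_point_summable[of "\<lambda>j. b (Suc j)", OF assms], of 3]
    by (simp add: mult_ac)
  finally show ?thesis by simp
qed

lemma plateau_cantor_point:
  assumes "\<And>j. b j \<le> 1"
  shows "plateau (3 ^ j * cantor_point b) = real (b j)"
  using assms
proof (induction j arbitrary: b)
  case 0
  let ?c = "cantor_point (\<lambda>j. b (Suc j))"
  have c: "0 \<le> ?c" "?c \<le> 1" using cantor_point_bounds[of "\<lambda>j. b (Suc j)"] 0 by auto
  have "wave (cantor_point b) = cantor_point b"
    by (intro wave_id cantor_point_bounds 0)
  hence eq: "3 * wave (cantor_point b) = 2 * real (b 0) + ?c"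
    using cantor_point_shift[OF 0] by simp
  have "b 0 = 0 \<or> b 0 = 1" using 0[of 0] by linarith
  thus ?case unfolding plateau_def using c eq by auto
next
  case (Suc j)
  have "3 ^ Suc j * cantor_point b = 3 ^ j * (3 * cantor_point b)" by simp
  also have "\<dots> = 3 ^ j * cantor_point (\<lambda>j. b (Suc j)) + 2 * real (3 ^ j * b 0)"
    unfolding cantor_point_shift[OF Suc.prems] by (simp add: algebra_simps)
  finally show ?case
    using Suc.IH[of "\<lambda>j. b (Suc j)"] Suc.prems by (simp only: plateau_periodic)
qed

text \<open>Assuming \<open>c < 1\<close> makes the digits those obtained from the integer parts of \<open>2\<^sup>k c\<close>.\<close>

lemma binary_expansion:
  fixes c :: real
  assumes "0 \<le> c" "c < 1"
  obtains b :: "nat \<Rightarrow> nat" where "\<And>k. b k \<le> 1" "(\<lambda>k. real (b k) / 2 ^ Suc k) sums c"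
proof -
  define e where "e k = \<lfloor>2 ^ Suc k * c\<rfloor> - 2 * \<lfloor>2 ^ k * c\<rfloor>" for k
  have e: "0 \<le> e k" "e k \<le> 1" for k
  proof -
    have "2 ^ Suc k * c = 2 * (2 ^ k * c)" by simp
    thus "0 \<le> e k" "e k \<le> 1" unfolding e_def by linarith+
  qed
  have partial: "(\<Sum>k<n. of_int (e k) / 2 ^ Suc k :: real) = of_int \<lfloor>2 ^ n * c\<rfloor> / 2 ^ n" for n
  proof (induction n)
    case 0
    have "\<lfloor>c\<rfloor> = 0" using assms by (simp add: floor_eq_iff)
    thus ?case by simp
  next
    case (Suc n)
    thus ?case unfolding e_def by (simp add: field_simps)
  qed
  have "(\<lambda>n. of_int \<lfloor>2 ^ n * c\<rfloor> / 2 ^ n) \<longlonglongrightarrow> c"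
  proof (rule tendsto_sandwich)
    show "\<forall>\<^sub>F n in sequentially. c - (1/2) ^ n \<le> of_int \<lfloor>2 ^ n * c\<rfloor> / 2 ^ n"
    proof (intro always_eventually allI)
      fix n
      have "2 ^ n * c - 1 \<le> of_int \<lfloor>2 ^ n * c\<rfloor>" by linarith
      hence "(2 ^ n * c - 1) / 2 ^ n \<le> of_int \<lfloor>2 ^ n * c\<rfloor> / 2 ^ n"
        by (intro divide_right_mono) auto
      thus "c - (1/2) ^ n \<le> of_int \<lfloor>2 ^ n * c\<rfloor> / 2 ^ n"
        by (simp add: diff_divide_distrib power_divide)
    qed
    show "\<forall>\<^sub>F n in sequentially. of_int \<lfloor>2 ^ n * c\<rfloor> / 2 ^ n \<le> c"
    proof (intro always_eventually allI)
      fix n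
      have "of_int \<lfloor>2 ^ n * c\<rfloor> \<le> 2 ^ n * c" by linarith
      thus "of_int \<lfloor>2 ^ n * c\<rfloor> / 2 ^ n \<le> c" by (simp add: field_simps)
    qed
    have "(\<lambda>n. c - (1/2) ^ n) \<longlonglongrightarrow> c - 0"
      by (intro tendsto_diff tendsto_const LIMSEQ_power_zero) simp
    thus "(\<lambda>n. c - (1/2) ^ n) \<longlonglongrightarrow> c" by simp
  qed simp
  hence "(\<lambda>k. of_int (e k) / 2 ^ Suc k) sums c" unfolding sums_def partial .
  moreover have "real (nat (e k)) = of_int (e k)" for k using e[of k] by simp
  ultimately show ?thesis using e by (intro that[of "\<lambda>k. nat (e k)"]) (auto simp: nat_le_iff)
qed

lemma sums_half: "(\<lambda>k. 1 / 2 ^ Suc k :: real) sums 1"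
  using power_half_series by (simp add: power_divide)

text \<open>
  Schoenberg's space-filling curve with countably many coordinates: for \<open>s\<close> in the
  Cantor set, the \<open>k\<close>-th binary digit of the \<open>n\<close>-th coordinate is half the ternary digit of \<open>s\<close> at
  the position encoding \<open>(n, k)\<close>.
\<close>

definition schoenberg :: "nat \<Rightarrow> real \<Rightarrow> real" where
  "schoenberg n s = (\<Sum>k. plateau (3 ^ prod_encode (n, k) * s) / 2 ^ Suc k)"

lemma continuous_on_schoenberg: "continuous_on UNIV (schoenberg n)"
  unfolding schoenberg_def
proof (rule continuous_on_suminf[OF _ _ sums_summable[OF sums_half]])
  show "continuous_on UNIV (\<lambda>s. plateau (3 ^ prod_encode (n, k) * s) / 2 ^ Suc k)" for k
    by (intro continuous_intros continuous_on_compose2[OF continuous_on_plateau]) auto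
  show "\<bar>plateau (3 ^ prod_encode (n, k) * s) / 2 ^ Suc k\<bar> \<le> 1 / 2 ^ Suc k" for k s
    using plateau_bounds by (simp add: divide_simps)
qed

lemma schoenberg_periodic: "schoenberg n (s + 2 * real m) = schoenberg n s"
proof -
  have "3 ^ j * (s + 2 * real m) = 3 ^ j * s + 2 * real (3 ^ j * m)" for j
    by (simp add: algebra_simps)
  thus ?thesis unfolding schoenberg_def by (simp only: plateau_periodic)
qed

lemma schoenberg_surj:
  fixes c :: "nat \<Rightarrow> real"
  assumes "\<And>n. 0 \<le> c n" "\<And>n. c n < 1"
  obtains s where "0 \<le> s" "s \<le> 1" "\<And>n. schoenberg n s = c n"
proof -
  have "\<exists>b :: nat \<Rightarrow> nat. (\<forall>k. b k \<le> 1) \<and> (\<lambda>k. real (b k) / 2 ^ Suc k) sums c n" for n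
    using binary_expansion[OF assms(1)[of n] assms(2)[of n]] by metis
  then obtain b :: "nat \<Rightarrow> nat \<Rightarrow> nat" where
    b: "\<And>n k. b n k \<le> 1" "\<And>n. (\<lambda>k. real (b n k) / 2 ^ Suc k) sums c n" by metis
  define d where "d j = (case prod_decode j of (n, k) \<Rightarrow> b n k)" for j
  have d: "d j \<le> 1" for j unfolding d_def using b(1) by (auto split: prod.split)
  have "schoenberg n (cantor_point d) = c n" for n
    unfolding schoenberg_def plateau_cantor_point[of d, OF d]
    using sums_unique[OF b(2)[of n]] by (simp add: d_def)
  thus ?thesis using cantor_point_bounds[of d, OF d] by (intro that)
qed

text \<open>
  The real line is a countable union of compact sets, so a continuous map from it to the space of
  all sequences cannot be onto; it can reach every bounded sequence, though. To this end the
  Schoenberg coordinates, rescaled to \<open>[-1, 1]\<close>, are multiplied by an amplitude that grows with \<open>s\<close>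
  but is constant on each of the intervals \<open>[2 m, 2 m + 1]\<close>. By periodicity every sequence in
  \<open>[-1, 1)\<close> is attained by the rescaled coordinates on each of these intervals.
\<close>

lemma coordinates_exist:
  obtains \<pi> :: "nat \<Rightarrow> real \<Rightarrow> real"
  where "\<And>n. continuous_on UNIV (\<pi> n)"
    and "\<And>(t :: nat \<Rightarrow> real) B. (\<And>n. \<bar>t n\<bar> \<le> B) \<Longrightarrow> \<exists>s. \<forall>n. \<pi> n s = t n"
proof
  \<comment> \<open>The factor \<open>(s - wave s) / 2\<close> is constantly \<open>m\<close> on \<open>[2 m, 2 m + 1]\<close>.\<close>
  define \<pi> where "\<pi> n s = (s - wave s) / 2 * (2 * schoenberg n s - 1)" for n s
  show "continuous_on UNIV (\<pi> n)" for n
    unfolding \<pi>_def by (intro continuous_intros continuous_on_wave continuous_on_schoenberg) auto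
  fix t :: "nat \<Rightarrow> real" and B assume B: "\<And>n. \<bar>t n\<bar> \<le> B"
  obtain m :: nat where m: "B < real m" using reals_Archimedean2 by blast
  have m0: "0 < real m" using B[of 0] m by linarith
  have tm: "\<bar>t n\<bar> < real m" for n using B[of n] m by linarith
  define c where "c n = (t n / real m + 1) / 2" for n
  have "- 1 < t n / real m" "t n / real m < 1" for n
    using tm[of n] m0 by (auto simp: field_simps abs_less_iff)
  hence "0 \<le> c n" "c n < 1" for n unfolding c_def by (auto simp: less_imp_le add_nonneg_nonneg)
      (smt (verit))
  then obtain s where s: "0 \<le> s" "s \<le> 1" "\<And>n. schoenberg n s = c n"
    using schoenberg_surj by metis
  have "\<pi> n (s + 2 * real m) = t n" for n
    unfolding \<pi>_def schoenberg_periodic wave_periodic wave_id[OF s(1,2)] s(3) c_def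
    using m0 by (simp add: field_simps)
  thus "\<exists>s. \<forall>n. \<pi> n s = t n" by blast
qed

section \<open>Nested sums\<close>

text \<open>
  The limit of the nested intervals of which the \<open>n\<close>-th has the endpoints \<open>u n\<close> and
  \<open>v n\<close> relative to its predecessor, the initial interval being \<open>[0, 1]\<close>. It is used only for
  \<open>0 \<le> u \<le> v \<le> 1/2\<close>, when the intervals do shrink to a point.
\<close>

definition nested_sum :: "(nat \<Rightarrow> real) \<Rightarrow> (nat \<Rightarrow> real) \<Rightarrow> real" where
  "nested_sum u v = (\<Sum>n. (\<Prod>k<n. v k - u k) * u n)"

lemma nested_sum_term_bounds:
  fixes u v :: "nat \<Rightarrow> real"
  assumes "\<And>k. 0 \<le> u k" "\<And>k. u k \<le> v k" "\<And>k. v k \<le> 1/2"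
  shows "0 \<le> (\<Prod>k<n. v k - u k) * u n" "(\<Prod>k<n. v k - u k) * u n \<le> 1 / 2 ^ Suc n"
proof -
  have p: "0 \<le> (\<Prod>k<n. v k - u k)" using assms by (intro prod_nonneg) auto
  thus "0 \<le> (\<Prod>k<n. v k - u k) * u n" using assms by simp
  have "v k - u k \<le> 1/2" for k using assms(1,3)[of k] by linarith
  hence "(\<Prod>k<n. v k - u k) \<le> (\<Prod>k<n. 1/2)" using assms by (intro prod_mono) auto
  moreover have "u n \<le> 1/2" using assms(2,3)[of n] by linarith
  ultimately have "(\<Prod>k<n. v k - u k) * u n \<le> (1/2) ^ n * (1/2)"
    using assms p by (intro mult_mono) auto
  thus "(\<Prod>k<n. v k - u k) * u n \<le> 1 / 2 ^ Suc n" by (simp add: power_divide)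
qed

lemma nested_sum_summable:
  fixes u v :: "nat \<Rightarrow> real"
  assumes "\<And>k. 0 \<le> u k" "\<And>k. u k \<le> v k" "\<And>k. v k \<le> 1/2"
  shows "summable (\<lambda>n. (\<Prod>k<n. v k - u k) * u n)"
  by (rule summable_comparison_test'[OF sums_summable[OF sums_half], of 0])
    (use nested_sum_term_bounds[of u v, OF assms] in auto)

lemma nested_sum_rec:
  fixes u v :: "nat \<Rightarrow> real"
  assumes "\<And>k. 0 \<le> u k" "\<And>k. u k \<le> v k" "\<And>k. v k \<le> 1/2"
  shows "nested_sum u v = u 0 + (v 0 - u 0) * nested_sum (\<lambda>k. u (Suc k)) (\<lambda>k. v (Suc k))"
proof -
  have "nested_sum u v = u 0 + (\<Sum>n. (\<Prod>k<Suc n. v k - u k) * u (Suc n))"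
    unfolding nested_sum_def using suminf_split_head[OF nested_sum_summable[of u v, OF assms]] by simp
  also have "(\<lambda>n. (\<Prod>k<Suc n. v k - u k) * u (Suc n)) =
      (\<lambda>n. (v 0 - u 0) * ((\<Prod>k<n. v (Suc k) - u (Suc k)) * u (Suc n)))"
    unfolding prod.lessThan_Suc_shift by (simp add: mult.assoc)
  also have "(\<Sum>n. (v 0 - u 0) * ((\<Prod>k<n. v (Suc k) - u (Suc k)) * u (Suc n))) =
      (v 0 - u 0) * nested_sum (\<lambda>k. u (Suc k)) (\<lambda>k. v (Suc k))"
    unfolding nested_sum_def
    by (rule suminf_mult) (intro nested_sum_summable assms)
  finally show ?thesis .
qed

lemma nested_sum_bounds:
  fixes u v :: "nat \<Rightarrow> real"
  assumes "\<And>k. 0 \<le> u k" "\<And>k. u k \<le> v k" "\<And>k. v k \<le> 1/2"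
  shows "u 0 \<le> nested_sum u v" "nested_sum u v \<le> v 0"
proof -
  let ?T = "nested_sum (\<lambda>k. u (Suc k)) (\<lambda>k. v (Suc k))"
  note S = nested_sum_summable[of "\<lambda>k. u (Suc k)" "\<lambda>k. v (Suc k)", OF assms]
  note b = nested_sum_term_bounds[of "\<lambda>k. u (Suc k)" "\<lambda>k. v (Suc k)", OF assms]
  have 0: "0 \<le> ?T" unfolding nested_sum_def by (intro suminf_nonneg S b(1))
  have "?T \<le> (\<Sum>n. 1 / 2 ^ Suc n)"
    unfolding nested_sum_def by (intro suminf_le b(2) S sums_summable[OF sums_half])
  hence 1: "?T \<le> 1" using sums_unique[OF sums_half] by simp
  have d: "0 \<le> v 0 - u 0" using assms(2)[of 0] by simp
  show "u 0 \<le> nested_sum u v" unfolding nested_sum_rec[of u v, OF assms] using d 0 by simp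
  show "nested_sum u v \<le> v 0"
    unfolding nested_sum_rec[of u v, OF assms] using mult_left_mono[OF 1 d] by simp
qed

lemma nested_sum_mono:
  fixes u v u' v' :: "nat \<Rightarrow> real"
  assumes "\<And>k. 0 \<le> u k" "\<And>k. u k \<le> v k" "\<And>k. v k \<le> 1/2"
    and "\<And>k. 0 \<le> u' k" "\<And>k. u' k \<le> v' k" "\<And>k. v' k \<le> 1/2"
    and "\<And>k. k < n \<Longrightarrow> u k = u' k" "\<And>k. k < n \<Longrightarrow> v k = v' k"
    and "v n \<le> u' n"
  shows "nested_sum u v \<le> nested_sum u' v'"
  using assms
proof (induction n arbitrary: u v u' v')
  case 0
  thus ?case using nested_sum_bounds(2)[of u v] nested_sum_bounds(1)[of u' v'] by fastforce
next
  case (Suc n)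
  have "nested_sum (\<lambda>k. u (Suc k)) (\<lambda>k. v (Suc k)) \<le> nested_sum (\<lambda>k. u' (Suc k)) (\<lambda>k. v' (Suc k))"
    by (rule Suc.IH) (use Suc.prems in auto)
  moreover have "u 0 = u' 0" "v 0 = v' 0" "0 \<le> v 0 - u 0" using Suc.prems(2,7,8)[of 0] by auto
  ultimately show ?case
    unfolding nested_sum_rec[of u v, OF Suc.prems(1-3)] nested_sum_rec[of u' v', OF Suc.prems(4-6)]
    by (simp add: mult_left_mono)
qed

lemma nested_sum_strict_mono:
  fixes u v u' v' :: "nat \<Rightarrow> real"
  assumes "\<And>k. 0 \<le> u k" "\<And>k. u k \<le> v k" "\<And>k. v k \<le> 1/2"
    and "\<And>k. 0 \<le> u' k" "\<And>k. u' k \<le> v' k" "\<And>k. v' k \<le> 1/2"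
    and "\<And>k. k < n \<Longrightarrow> u k = u' k" "\<And>k. k < n \<Longrightarrow> v k = v' k"
    and "\<And>k. k < n \<Longrightarrow> u k < v k" "v n < u' n"
  shows "nested_sum u v < nested_sum u' v'"
  using assms
proof (induction n arbitrary: u v u' v')
  case 0
  thus ?case using nested_sum_bounds(2)[of u v] nested_sum_bounds(1)[of u' v'] by fastforce
next
  case (Suc n)
  have "nested_sum (\<lambda>k. u (Suc k)) (\<lambda>k. v (Suc k)) < nested_sum (\<lambda>k. u' (Suc k)) (\<lambda>k. v' (Suc k))"
    by (rule Suc.IH) (use Suc.prems in auto)
  moreover have "u 0 = u' 0" "v 0 = v' 0" "0 < v 0 - u 0" using Suc.prems(7,8,9)[of 0] by auto
  ultimately show ?case
    unfolding nested_sum_rec[of u v, OF Suc.prems(1-3)] nested_sum_rec[of u' v', OF Suc.prems(4-6)]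
    by simp
qed

text \<open>A pair of Baire 1 functions \<open>f < g\<close> with values in \<open>[0, 1/2]\<close>.\<close>

definition bracket :: "(real \<Rightarrow> real) \<times> (real \<Rightarrow> real) \<Rightarrow> bool" where
  "bracket p \<longleftrightarrow> baire1 (fst p) \<and> baire1 (snd p) \<and> fst p < snd p \<and>
     (\<forall>s. 0 \<le> fst p s \<and> snd p s \<le> 1/2)"

lemma fun_less_ex: "f < (g :: real \<Rightarrow> real) \<Longrightarrow> \<exists>t. f t < g t"
  by (auto simp: less_fun_def le_fun_def not_le)

text \<open>
  An operation turning sequences of brackets into Baire 1 functions that is strictly monotone
  for the lexicographic order, where a bracket is smaller than another if it lies entirely below it.
\<close>

definition nesting ::
    "((nat \<Rightarrow> (real \<Rightarrow> real) \<times> (real \<Rightarrow> real)) \<Rightarrow> real \<Rightarrow> real) \<Rightarrow> bool" where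
  "nesting N \<longleftrightarrow> (\<forall>p. (\<forall>k. bracket (p k)) \<longrightarrow> baire1 (N p)) \<and>
     (\<forall>p q n. (\<forall>k. bracket (p k)) \<longrightarrow> (\<forall>k. bracket (q k)) \<longrightarrow> (\<forall>k<n. p k = q k) \<longrightarrow>
        snd (p n) < fst (q n) \<longrightarrow> N p < N q)"

lemma nesting_baire1: "nesting N \<Longrightarrow> (\<And>k. bracket (p k)) \<Longrightarrow> baire1 (N p)"
  by (simp add: nesting_def)

lemma nesting_less:
  assumes "nesting N" "\<And>k. bracket (p k)" "\<And>k. bracket (q k)"
    and "\<And>k. k < n \<Longrightarrow> p k = q k" "snd (p n) < fst (q n)"
  shows "N p < N q"
  using assms unfolding nesting_def by metis

lemma nesting_exists: "\<exists>N. nesting N"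
proof -
  obtain \<pi> :: "nat \<Rightarrow> real \<Rightarrow> real" where cont: "\<And>n. continuous_on UNIV (\<pi> n)"
    and onto: "\<And>(t :: nat \<Rightarrow> real) B. (\<And>n. \<bar>t n\<bar> \<le> B) \<Longrightarrow> \<exists>s. \<forall>n. \<pi> n s = t n"
    using coordinates_exist by metis
  define N where "N p s = nested_sum (\<lambda>k. fst (p k) (\<pi> k s)) (\<lambda>k. snd (p k) (\<pi> k s))"
    for p :: "nat \<Rightarrow> (real \<Rightarrow> real) \<times> (real \<Rightarrow> real)" and s
  have bnd: "0 \<le> fst (p k) t" "fst (p k) t \<le> snd (p k) t" "snd (p k) t \<le> 1/2"
    if "\<And>k. bracket (p k)" for p :: "nat \<Rightarrow> (real \<Rightarrow> real) \<times> (real \<Rightarrow> real)" and k t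
    using that[of k] by (auto simp: bracket_def less_fun_def le_fun_def)
  have "nesting N"
    unfolding nesting_def
  proof (intro conjI allI impI)
    fix p :: "nat \<Rightarrow> (real \<Rightarrow> real) \<times> (real \<Rightarrow> real)"
    assume "\<forall>k. bracket (p k)"
    hence p: "\<And>k. bracket (p k)" by blast
    have b: "baire1 (\<lambda>s. fst (p k) (\<pi> k s))" "baire1 (\<lambda>s. snd (p k) (\<pi> k s))" for k
      using p[of k] by (auto simp: bracket_def intro: baire1_compose_inner cont)
    show "baire1 (N p)"
      unfolding N_def nested_sum_def
    proof (rule baire1_suminf[OF _ _ sums_summable[OF sums_half]])
      show "baire1 (\<lambda>s. (\<Prod>k<n. snd (p k) (\<pi> k s) - fst (p k) (\<pi> k s)) * fst (p n) (\<pi> n s))" for n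
        by (intro baire1_mult baire1_prod baire1_diff b)
      fix n s
      show "\<bar>(\<Prod>k<n. snd (p k) (\<pi> k s) - fst (p k) (\<pi> k s)) * fst (p n) (\<pi> n s)\<bar> \<le> 1 / 2 ^ Suc n"
        using nested_sum_term_bounds[of "\<lambda>k. fst (p k) (\<pi> k s)" "\<lambda>k. snd (p k) (\<pi> k s)" n]
          bnd[of p, OF p] by simp
    qed
  next
    fix p q :: "nat \<Rightarrow> (real \<Rightarrow> real) \<times> (real \<Rightarrow> real)" and n
    assume "\<forall>k. bracket (p k)" "\<forall>k. bracket (q k)" "\<forall>k<n. p k = q k"
      and less: "snd (p n) < fst (q n)"
    hence p: "\<And>k. bracket (p k)" and q: "\<And>k. bracket (q k)"
      and eq: "\<And>k. k < n \<Longrightarrow> p k = q k" by blast+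
    have "N p s \<le> N q s" for s
      unfolding N_def
      by (rule nested_sum_mono[where n = n])
        (use bnd[of p, OF p] bnd[of q, OF q] eq less in \<open>auto simp: less_fun_def le_fun_def\<close>)
    moreover have "\<exists>s. N p s < N q s"
    proof -
      \<comment> \<open>One point witnesses each of the finitely many strict inequalities; the joint
        surjectivity of the coordinates realizes all of them at a single \<open>s\<close>.\<close>
      have "\<exists>t. fst (p k) t < snd (p k) t" for k
        using p[of k] by (intro fun_less_ex) (simp add: bracket_def)
      then obtain t where t: "\<And>k. fst (p k) (t k) < snd (p k) (t k)" by metis
      obtain t' where t': "snd (p n) t' < fst (q n) t'" using fun_less_ex[OF less] by blast
      have tq: "fst (q k) (t k) < snd (q k) (t k)" if "k < n" for k using t[of k] eq[OF that] by simp
      define x where "x k = (if k < n then t k else if k = n then t' else 0)" for k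
      have "\<bar>x k\<bar> \<le> (\<Sum>k<Suc n. \<bar>x k\<bar>)" for k
      proof (cases "k < Suc n")
        case True
        thus ?thesis by (intro member_le_sum) auto
      next
        case False
        hence "x k = 0" unfolding x_def by auto
        thus ?thesis by (simp add: sum_nonneg)
      qed
      then obtain s where s: "\<And>k. \<pi> k s = x k" using onto by meson
      have "N p s < N q s"
        unfolding N_def
        by (rule nested_sum_strict_mono[where n = n])
          (use bnd[of p, OF p] bnd[of q, OF q] eq t tq t' in \<open>auto simp: s x_def\<close>)
      thus ?thesis ..
    qed
    ultimately show "N p < N q"
      by (auto simp: less_fun_def le_fun_def not_le)
  qed
  thus ?thesis by blast
qed

section \<open>Representable ordered sets\<close>

text \<open>
  Between linear orders a strictly increasing map is a similarity onto its image. Antisymmetry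
  of \<open>r\<close> need not be assumed, as it follows from strict monotonicity.
\<close>

lemma representableI:
  fixes r :: "'a rel"
  assumes refl: "\<And>x. x \<in> Field r \<Longrightarrow> (x, x) \<in> r"
    and total: "\<And>x y. x \<in> Field r \<Longrightarrow> y \<in> Field r \<Longrightarrow> x \<noteq> y \<Longrightarrow> (x, y) \<in> r \<or> (y, x) \<in> r"
    and baire: "\<And>x. x \<in> Field r \<Longrightarrow> baire1 (\<Phi> x)"
    and mono: "\<And>x y. x \<in> Field r \<Longrightarrow> y \<in> Field r \<Longrightarrow> x \<noteq> y \<Longrightarrow> (x, y) \<in> r \<Longrightarrow> \<Phi> x < \<Phi> y"
  shows "representable r"
proof -
  let ?A = "\<Phi> ` Field r"
  let ?R = "{(f, g). f \<in> ?A \<and> g \<in> ?A \<and> f \<le> g}"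
  have ord: "(x, y) \<in> r \<longleftrightarrow> \<Phi> x \<le> \<Phi> y" if "x \<in> Field r" "y \<in> Field r" for x y
    using refl[OF that(1)] total[OF that] mono[OF that] mono[OF that(2,1)]
    by (cases "x = y") (auto dest: less_imp_le simp: less_le_not_le)
  have inj: "inj_on \<Phi> (Field r)"
  proof (rule inj_onI, rule ccontr)
    fix x y assume xy: "x \<in> Field r" "y \<in> Field r" "\<Phi> x = \<Phi> y" "x \<noteq> y"
    show False using total[OF xy(1,2,4)] mono[OF xy(1,2,4)] mono[OF xy(2,1)] xy(3,4) by auto
  qed
  have "Field ?R = ?A" unfolding Field_def by auto
  hence "similar r ?R"
    unfolding similar_def using inj ord by (intro exI[of _ \<Phi>]) (auto simp: bij_betw_def)
  moreover have "\<forall>f\<in>?A. \<forall>g\<in>?A. f \<le> g \<or> g \<le> f"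
    using ord total refl by (metis (no_types, lifting) imageE)
  ultimately show ?thesis
    unfolding representable_def using baire by (intro exI[of _ ?A]) auto
qed

lemma representableE:
  fixes r :: "'a rel"
  assumes "representable r"
  obtains \<Phi> where "\<And>x. x \<in> Field r \<Longrightarrow> (x, x) \<in> r"
    and "\<And>x y. x \<in> Field r \<Longrightarrow> y \<in> Field r \<Longrightarrow> x \<noteq> y \<Longrightarrow> (x, y) \<in> r \<or> (y, x) \<in> r"
    and "\<And>x. x \<in> Field r \<Longrightarrow> baire1 (\<Phi> x)"
    and "\<And>x y. x \<in> Field r \<Longrightarrow> y \<in> Field r \<Longrightarrow> x \<noteq> y \<Longrightarrow> (x, y) \<in> r \<Longrightarrow> \<Phi> x < \<Phi> y"
proof -
  obtain A :: "(real \<Rightarrow> real) set" where A: "\<forall>f\<in>A. baire1 f" "\<forall>f\<in>A. \<forall>g\<in>A. f \<le> g \<or> g \<le> f"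
    "similar r {(f, g). f \<in> A \<and> g \<in> A \<and> f \<le> g}"
    using assms unfolding representable_def by blast
  have "Field {(f, g). f \<in> A \<and> g \<in> A \<and> f \<le> g} = A" unfolding Field_def by auto
  then obtain \<Phi> where bij: "bij_betw \<Phi> (Field r) A"
    and ord: "\<And>x y. x \<in> Field r \<Longrightarrow> y \<in> Field r \<Longrightarrow> (x, y) \<in> r \<longleftrightarrow> \<Phi> x \<in> A \<and> \<Phi> y \<in> A \<and> \<Phi> x \<le> \<Phi> y"
    using A(3) unfolding similar_def by auto
  have mem: "\<Phi> x \<in> A" if "x \<in> Field r" for x using bij that by (auto simp: bij_betw_def)
  have neq: "\<Phi> x \<noteq> \<Phi> y" if "x \<in> Field r" "y \<in> Field r" "x \<noteq> y" for x y
    using bij that by (auto simp: bij_betw_def inj_on_def)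
  show ?thesis
  proof (rule that[of \<Phi>])
    show "(x, x) \<in> r" if "x \<in> Field r" for x using that ord mem by auto
    show "(x, y) \<in> r \<or> (y, x) \<in> r" if "x \<in> Field r" "y \<in> Field r" for x y
      using that ord mem A(2) by auto
    show "baire1 (\<Phi> x)" if "x \<in> Field r" for x using mem[OF that] A(1) by blast
    show "\<Phi> x < \<Phi> y" if "x \<in> Field r" "y \<in> Field r" "x \<noteq> y" "(x, y) \<in> r" for x y
      using ord[OF that(1,2)] neq[OF that(1-3)] that(4) by (simp add: order.strict_iff_order)
  qed
qed

lemma representable_Restr:
  assumes "representable r" "Y \<subseteq> Field r"
  shows "representable (Restr r Y)"
proof -
  obtain \<Phi> where \<Phi>: "\<And>x. x \<in> Field r \<Longrightarrow> (x, x) \<in> r"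
    "\<And>x y. x \<in> Field r \<Longrightarrow> y \<in> Field r \<Longrightarrow> x \<noteq> y \<Longrightarrow> (x, y) \<in> r \<or> (y, x) \<in> r"
    "\<And>x. x \<in> Field r \<Longrightarrow> baire1 (\<Phi> x)"
    "\<And>x y. x \<in> Field r \<Longrightarrow> y \<in> Field r \<Longrightarrow> x \<noteq> y \<Longrightarrow> (x, y) \<in> r \<Longrightarrow> \<Phi> x < \<Phi> y"
    using assms(1) by (rule representableE) (rule that, assumption+)
  have mem: "x \<in> Y" "x \<in> Field r" if "x \<in> Field (Restr r Y)" for x
    using that by (auto simp: Field_def)
  show ?thesis
  proof (rule representableI[of _ \<Phi>])
    fix x assume x: "x \<in> Field (Restr r Y)"
    show "(x, x) \<in> Restr r Y" using mem[OF x] \<Phi>(1) by simp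
    show "baire1 (\<Phi> x)" using mem[OF x] \<Phi>(3) by simp
    fix y assume y: "y \<in> Field (Restr r Y)" "x \<noteq> y"
    show "(x, y) \<in> Restr r Y \<or> (y, x) \<in> Restr r Y"
      using mem[OF x] mem[OF y(1)] y(2) \<Phi>(2)[of x y] by simp
    assume "(x, y) \<in> Restr r Y"
    thus "\<Phi> x < \<Phi> y" using mem[OF x] mem[OF y(1)] y(2) by (intro \<Phi>(4)) auto
  qed
qed

lemma representable_dir_image:
  assumes "representable r" "inj f"
  shows "representable (dir_image r f)"
proof -
  have "similar (dir_image r f) r"
    unfolding similar_def dir_image_Field
  proof (intro exI[of _ "inv f"] conjI)
    have "inj_on (inv f) (f ` Field r)" by (rule inj_on_inv_into) auto
    thus "bij_betw (inv f) (f ` Field r) (Field r)"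
      using assms(2) by (simp add: bij_betw_def image_image inv_f_f)
    show "\<forall>x\<in>f ` Field r. \<forall>y\<in>f ` Field r. (x, y) \<in> dir_image r f \<longleftrightarrow> (inv f x, inv f y) \<in> r"
      using assms(2) by (auto simp: dir_image_def inv_f_f inj_eq)
  qed
  thus ?thesis using assms(1) similar_trans unfolding representable_def by blast
qed

section \<open>Ordered sets with representable duplication\<close>

text \<open>
  A linear order whose duplication is representable: the functions representing \<open>(x, 0)\<close> and
  \<open>(x, 1)\<close>, squeezed into \<open>[0, 1/2]\<close>, form the bracket \<open>E x\<close>.
\<close>

definition bracketed :: "'a rel \<Rightarrow> bool" where
  "bracketed X \<longleftrightarrow> (\<forall>x\<in>Field X. (x, x) \<in> X) \<and> total_on (Field X) X \<and>
     (\<exists>E. (\<forall>x\<in>Field X. bracket (E x)) \<and>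
        (\<forall>x\<in>Field X. \<forall>y\<in>Field X. x \<noteq> y \<longrightarrow> (x, y) \<in> X \<longrightarrow> snd (E x) < fst (E y)))"

lemma fun_less_compose:
  assumes "f < (g :: real \<Rightarrow> real)" "strict_mono h"
  shows "(\<lambda>s. h (f s)) < (\<lambda>s. h (g s) :: real)"
  using assms by (auto simp: less_fun_def le_fun_def strict_mono_less_eq)

lemma bracketedI:
  assumes refl: "\<And>x. x \<in> Field X \<Longrightarrow> (x, x) \<in> X" and total: "total_on (Field X) X"
    and baire: "\<And>x. x \<in> Field X \<Longrightarrow> baire1 (lo x)" "\<And>x. x \<in> Field X \<Longrightarrow> baire1 (hi x)"
    and less: "\<And>x. x \<in> Field X \<Longrightarrow> lo x < hi x"
      "\<And>x y. x \<in> Field X \<Longrightarrow> y \<in> Field X \<Longrightarrow> x \<noteq> y \<Longrightarrow> (x, y) \<in> X \<Longrightarrow> hi x < lo y"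
  shows "bracketed X"
proof -
  define h where "h s = arctan s / (2 * pi) + 1/4" for s
  have mono: "strict_mono h"
    unfolding h_def strict_mono_def by (simp add: divide_strict_right_mono arctan_less_iff)
  have cont: "continuous_on UNIV h"
    unfolding h_def by (intro continuous_intros) auto
  have bounds: "0 \<le> h s" "h s \<le> 1/2" for s
    using arctan_lbound[of s] arctan_ubound[of s] unfolding h_def by (auto simp: field_simps)
  define E where "E x = (\<lambda>s. h (lo x s), \<lambda>s. h (hi x s))" for x
  have "bracket (E x)" if "x \<in> Field X" for x
    unfolding bracket_def E_def using that bounds
    by (auto intro: baire1_compose_outer cont baire fun_less_compose less mono)
  moreover have "snd (E x) < fst (E y)"
    if "x \<in> Field X" "y \<in> Field X" "x \<noteq> y" "(x, y) \<in> X" for x y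
    unfolding E_def using fun_less_compose[OF less(2)[OF that] mono] by simp
  ultimately show ?thesis unfolding bracketed_def using refl total by blast
qed

lemma bracketedE:
  assumes "bracketed X"
  obtains E where "\<And>x. x \<in> Field X \<Longrightarrow> bracket (E x)"
    and "\<And>x y. x \<in> Field X \<Longrightarrow> y \<in> Field X \<Longrightarrow> x \<noteq> y \<Longrightarrow> (x, y) \<in> X \<Longrightarrow> snd (E x) < fst (E y)"
proof -
  obtain E where "\<forall>x\<in>Field X. bracket (E x)"
    "\<forall>x\<in>Field X. \<forall>y\<in>Field X. x \<noteq> y \<longrightarrow> (x, y) \<in> X \<longrightarrow> snd (E x) < fst (E y)"
    using assms unfolding bracketed_def by (elim conjE exE)
  thus ?thesis by (intro that[of E]) simp_all
qed

lemma bracketed_duplication: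
  assumes "representable (duplication X)"
    and refl: "\<And>x. x \<in> Field X \<Longrightarrow> (x, x) \<in> X" and total: "total_on (Field X) X"
  shows "bracketed X"
proof -
  obtain \<Phi> where baire: "\<And>x. x \<in> Field (duplication X) \<Longrightarrow> baire1 (\<Phi> x)"
    and less: "\<And>x y. x \<in> Field (duplication X) \<Longrightarrow> y \<in> Field (duplication X) \<Longrightarrow> x \<noteq> y \<Longrightarrow>
      (x, y) \<in> duplication X \<Longrightarrow> \<Phi> x < \<Phi> y"
    using assms(1) by (rule representableE) (rule that, assumption+)
  show ?thesis
  proof (rule bracketedI[OF refl total])
    fix x assume x: "x \<in> Field X"
    show "baire1 (\<Phi> (x, 0))" "baire1 (\<Phi> (x, 1))"
      using x by (auto intro!: baire simp: Field_duplication)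
    show "\<Phi> (x, 0) < \<Phi> (x, 1)"
      using x by (intro less) (auto simp: Field_duplication, auto simp: duplication_def replace_points_def Field_natLeq_on)
    fix y assume "y \<in> Field X" "x \<noteq> y" "(x, y) \<in> X"
    thus "\<Phi> (x, 1) < \<Phi> (y, 0)"
      using x by (intro less) (auto simp: Field_duplication, auto simp: duplication_def replace_points_def Field_natLeq_on)
  qed
qed

lemma bracketed_representable:
  assumes "bracketed X"
  shows "representable X"
proof -
  obtain E where E: "\<And>x. x \<in> Field X \<Longrightarrow> bracket (E x)"
    "\<And>x y. x \<in> Field X \<Longrightarrow> y \<in> Field X \<Longrightarrow> x \<noteq> y \<Longrightarrow> (x, y) \<in> X \<Longrightarrow> snd (E x) < fst (E y)"
    using assms by (rule bracketedE) (rule that, assumption+)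
  show ?thesis
  proof (rule representableI[of _ "\<lambda>x. fst (E x)"])
    show "fst (E x) < fst (E y)"
      if "x \<in> Field X" "y \<in> Field X" "x \<noteq> y" "(x, y) \<in> X" for x y
      using E(1)[OF that(1)] E(2)[OF that] by (auto simp: bracket_def)
  qed (use assms E in \<open>auto simp: bracketed_def bracket_def total_on_def\<close>)
qed

lemma bracketed_similar:
  assumes "similar X Z" "bracketed Z"
  shows "bracketed X"
proof -
  obtain f where bij: "bij_betw f (Field X) (Field Z)"
    and ord: "\<And>x y. x \<in> Field X \<Longrightarrow> y \<in> Field X \<Longrightarrow> (x, y) \<in> X \<longleftrightarrow> (f x, f y) \<in> Z"
    using assms(1) unfolding similar_def by blast
  have mem: "f x \<in> Field Z" if "x \<in> Field X" for x using bij that by (auto simp: bij_betw_def)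
  have neq: "f x \<noteq> f y" if "x \<in> Field X" "y \<in> Field X" "x \<noteq> y" for x y
    using bij that by (auto simp: bij_betw_def inj_on_def)
  obtain E where E: "\<And>x. x \<in> Field Z \<Longrightarrow> bracket (E x)"
    "\<And>x y. x \<in> Field Z \<Longrightarrow> y \<in> Field Z \<Longrightarrow> x \<noteq> y \<Longrightarrow> (x, y) \<in> Z \<Longrightarrow> snd (E x) < fst (E y)"
    using assms(2) by (rule bracketedE) (rule that, assumption+)
  have "\<forall>x\<in>Field X. bracket (E (f x))" using E(1) mem by blast
  moreover have "\<forall>x\<in>Field X. \<forall>y\<in>Field X. x \<noteq> y \<longrightarrow> (x, y) \<in> X \<longrightarrow> snd (E (f x)) < fst (E (f y))"
    using E(2) mem neq ord by blast
  moreover have "\<forall>x\<in>Field X. (x, x) \<in> X" using assms(2) mem ord by (auto simp: bracketed_def)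
  moreover have "total_on (Field X) X"
  proof (rule total_onI)
    fix x y assume xy: "x \<in> Field X" "y \<in> Field X" "x \<noteq> y"
    have "total_on (Field Z) Z" using assms(2) by (simp add: bracketed_def)
    hence "(f x, f y) \<in> Z \<or> (f y, f x) \<in> Z"
      using mem neq xy unfolding total_on_def by simp
    thus "(x, y) \<in> X \<or> (y, x) \<in> X" using ord xy by simp
  qed
  ultimately show ?thesis
    unfolding bracketed_def by (intro conjI exI[of _ "\<lambda>x. E (f x)"])
qed

lemma bracketed_dir_image:
  assumes "bracketed X" "inj_on f (Field X)"
  shows "bracketed (dir_image X f)"
proof (rule bracketed_similar[OF _ assms(1)])
  let ?g = "inv_into (Field X) f"
  have inv: "?g (f x) = x" if "x \<in> Field X" for x using assms(2) that by simp
  have "\<forall>x\<in>f ` Field X. \<forall>y\<in>f ` Field X. (x, y) \<in> dir_image X f \<longleftrightarrow> (?g x, ?g y) \<in> X"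
  proof (intro ballI)
    fix x y assume "x \<in> f ` Field X" "y \<in> f ` Field X"
    then obtain x' y' where xy: "x' \<in> Field X" "y' \<in> Field X" "x = f x'" "y = f y'" by blast
    have "(f x', f y') \<in> dir_image X f \<longleftrightarrow> (x', y') \<in> X"
    proof
      assume "(f x', f y') \<in> dir_image X f"
      then obtain a b where "(a, b) \<in> X" "f a = f x'" "f b = f y'" by (auto simp: dir_image_def)
      moreover from this have "a = x'" "b = y'"
        using assms(2) xy by (auto simp: inj_on_def intro: FieldI1 FieldI2)
      ultimately show "(x', y') \<in> X" by simp
    qed (auto simp: dir_image_def)
    thus "(x, y) \<in> dir_image X f \<longleftrightarrow> (?g x, ?g y) \<in> X" using xy inv by simp
  qed
  moreover have "bij_betw ?g (f ` Field X) (Field X)"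
    using assms(2) by (intro bij_betw_inv_into) (simp add: inj_on_imp_bij_betw)
  ultimately show "similar (dir_image X f) X"
    unfolding similar_def dir_image_Field by blast
qed

lemma bracketed_empty: "bracketed {}"
  unfolding bracketed_def by (simp add: total_on_def)

lemma bracket_const: "0 \<le> a \<Longrightarrow> a < b \<Longrightarrow> b \<le> 1/2 \<Longrightarrow> bracket (\<lambda>_. a, \<lambda>_. b)"
  unfolding bracket_def by (auto simp: baire1_continuous less_fun_def le_fun_def)

lemma Field_replace_points:
  assumes "\<And>x y. x \<in> Field X \<Longrightarrow> y \<in> Field (Y x) \<Longrightarrow> (y, y) \<in> Y x"
  shows "Field (replace_points X Y) = (SIGMA x:Field X. Field (Y x))"
proof
  show "Field (replace_points X Y) \<subseteq> (SIGMA x:Field X. Field (Y x))"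
    unfolding replace_points_def Field_def by auto
  show "(SIGMA x:Field X. Field (Y x)) \<subseteq> Field (replace_points X Y)"
  proof
    fix z assume "z \<in> (SIGMA x:Field X. Field (Y x))"
    hence "(z, z) \<in> replace_points X Y" using assms by (auto simp: replace_points_def)
    thus "z \<in> Field (replace_points X Y)" by (rule FieldI1)
  qed
qed

text \<open>
  The two functions required for a point \<open>(x, y)\<close> come from a third level of nesting, below those of
  \<open>x\<close> and \<open>y\<close>, with two constant brackets \<open>c\<^sub>0\<close> and \<open>c\<^sub>1\<close> standing for the points of \<open>{0, 1}\<close>.
\<close>

lemma bracketed_replace_points:
  assumes X: "bracketed X" and Y: "\<And>x. x \<in> Field X \<Longrightarrow> bracketed (Y x)"
  shows "bracketed (replace_points X Y)"
proof -
  have refl: "\<And>x. x \<in> Field X \<Longrightarrow> (x, x) \<in> X"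
    "\<And>x y. x \<in> Field X \<Longrightarrow> y \<in> Field (Y x) \<Longrightarrow> (y, y) \<in> Y x"
    using X Y by (auto simp: bracketed_def)
  have F: "Field (replace_points X Y) = (SIGMA x:Field X. Field (Y x))"
    by (rule Field_replace_points) (rule refl(2))
  obtain N where N: "nesting N" using nesting_exists by blast
  note N_baire = nesting_baire1[OF N] and N_less = nesting_less[OF N]
  obtain E where E: "\<And>x. x \<in> Field X \<Longrightarrow> bracket (E x)"
    "\<And>x y. x \<in> Field X \<Longrightarrow> y \<in> Field X \<Longrightarrow> x \<noteq> y \<Longrightarrow> (x, y) \<in> X \<Longrightarrow> snd (E x) < fst (E y)"
    using X by (rule bracketedE) (rule that, assumption+)
  have "\<exists>D. (\<forall>y\<in>Field (Y x). bracket (D y)) \<and>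
      (\<forall>y\<in>Field (Y x). \<forall>z\<in>Field (Y x). y \<noteq> z \<longrightarrow> (y, z) \<in> Y x \<longrightarrow> snd (D y) < fst (D z))"
    if "x \<in> Field X" for x
    using Y[OF that] unfolding bracketed_def by blast
  then obtain D where D: "\<And>x y. x \<in> Field X \<Longrightarrow> y \<in> Field (Y x) \<Longrightarrow> bracket (D x y)"
    "\<And>x y z. x \<in> Field X \<Longrightarrow> y \<in> Field (Y x) \<Longrightarrow> z \<in> Field (Y x) \<Longrightarrow> y \<noteq> z \<Longrightarrow> (y, z) \<in> Y x
      \<Longrightarrow> snd (D x y) < fst (D x z)"
    by metis
  define P where "P c z k = (if k = 0 then E (fst z) else if k = 1 then D (fst z) (snd z) else c)"
    for c z and k :: nat
  define c\<^sub>0 c\<^sub>1 :: "(real \<Rightarrow> real) \<times> (real \<Rightarrow> real)"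
    where "c\<^sub>0 = (\<lambda>_. 0, \<lambda>_. 1/8)" and "c\<^sub>1 = (\<lambda>_. 1/4, \<lambda>_. 1/2)"
  have c: "bracket c\<^sub>0" "bracket c\<^sub>1" "snd c\<^sub>0 < fst c\<^sub>1"
    unfolding c\<^sub>0_def c\<^sub>1_def by (auto intro!: bracket_const simp: less_fun_def le_fun_def)
  have P: "bracket (P c z k)" if "z \<in> Field (replace_points X Y)" "bracket c" for c z k
    using that E(1) D(1) unfolding P_def F by auto
  show ?thesis
  proof (rule bracketedI[where lo = "\<lambda>z. N (P c\<^sub>0 z)" and hi = "\<lambda>z. N (P c\<^sub>1 z)"])
    fix z assume z: "z \<in> Field (replace_points X Y)"
    show "(z, z) \<in> replace_points X Y"
      using z refl unfolding F by (auto simp: replace_points_def)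
    show "baire1 (N (P c\<^sub>0 z))" "baire1 (N (P c\<^sub>1 z))"
      using N_baire[of "P c\<^sub>0 z"] N_baire[of "P c\<^sub>1 z"] P[OF z c(1)] P[OF z c(2)] by simp_all
    show "N (P c\<^sub>0 z) < N (P c\<^sub>1 z)"
      by (rule N_less[of "P c\<^sub>0 z" "P c\<^sub>1 z" 2, OF P[OF z c(1)] P[OF z c(2)]]) (simp_all add: P_def c)
    fix z' assume z': "z' \<in> Field (replace_points X Y)" "z \<noteq> z'" "(z, z') \<in> replace_points X Y"
    note less = N_less[of "P c\<^sub>1 z" "P c\<^sub>0 z'", OF P[OF z c(2)] P[OF z'(1) c(1)]]
    show "N (P c\<^sub>1 z) < N (P c\<^sub>0 z')"
    proof (cases "fst z = fst z'")
      case True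
      have "snd z \<noteq> snd z'" using True z'(2) by (simp add: prod_eq_iff)
      moreover have "(snd z, snd z') \<in> Y (fst z)"
        using True z'(3) by (auto simp: replace_points_def)
      ultimately have "snd (P c\<^sub>1 z 1) < fst (P c\<^sub>0 z' 1)"
        using True z[unfolded F] z'(1)[unfolded F] D(2)[of "fst z" "snd z" "snd z'"]
        by (auto simp: P_def)
      thus ?thesis using True by (intro less[of 1]) (simp_all add: P_def)
    next
      case False
      have "snd (P c\<^sub>1 z 0) < fst (P c\<^sub>0 z' 0)"
        using False z[unfolded F] z'(1)[unfolded F] z'(3) E(2)[of "fst z" "fst z'"]
        by (auto simp: P_def replace_points_def)
      thus ?thesis by (intro less[of 0]) simp_all
    qed
  next
    show "total_on (Field (replace_points X Y)) (replace_points X Y)"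
    proof (rule total_onI)
      fix z z' assume zz': "z \<in> Field (replace_points X Y)" "z' \<in> Field (replace_points X Y)" "z \<noteq> z'"
      obtain x y x' y' where z: "z = (x, y)" "z' = (x', y')" by (cases z, cases z')
      have mem: "x \<in> Field X" "x' \<in> Field X" "y \<in> Field (Y x)" "y' \<in> Field (Y x')"
        using zz'(1,2) unfolding F z by auto
      have "total_on (Field X) X" "total_on (Field (Y x)) (Y x)"
        using X Y[OF mem(1)] by (auto simp: bracketed_def)
      hence "x \<noteq> x' \<and> ((x, x') \<in> X \<or> (x', x) \<in> X) \<or> x = x' \<and> ((y, y') \<in> Y x \<or> (y', y) \<in> Y x)"
        using mem zz'(3) unfolding z total_on_def by (cases "x = x'") simp_all
      thus "(z, z') \<in> replace_points X Y \<or> (z', z) \<in> replace_points X Y"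
        unfolding replace_points_def z using mem by (elim disjE conjE) simp_all
    qed
  qed
qed

lemma bracketed_S_stage:
  fixes H :: "'a rel set"
  assumes H: "\<And>X. X \<in> H \<Longrightarrow> bracketed X" and w: "Well_order w"
  shows "Z \<in> S_stage H w i \<Longrightarrow> bracketed Z"
proof -
  have "wf (w - Id)" using w by (simp add: well_order_on_def)
  thus "Z \<in> S_stage H w i \<Longrightarrow> bracketed Z"
  proof (induction i arbitrary: Z rule: wf_induct_rule)
    case (less i)
    hence IH: "bracketed Z" if "Z \<in> (\<Union>j\<in>underS w i. S_stage H w j)" for Z
      using that by (auto simp: underS_def)
    show ?case
    proof (cases "underS w i = {}")
      case True
      hence "Z \<in> (\<lambda>X. dir_image X Point) ` H \<union> {{}}"
        using less.prems S_stage_rec[OF w, of H i] by simp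
      thus ?thesis using H by (auto simp: bracketed_empty intro!: bracketed_dir_image inj_onI)
    next
      case False
      then obtain X Y where Z: "Z = dir_image (replace_points X Y) (\<lambda>(x, y). Nest x y)"
        and X: "X \<in> (\<Union>j\<in>underS w i. S_stage H w j)"
        and Y: "\<forall>x\<in>Field X. Y x \<in> (\<Union>j\<in>underS w i. S_stage H w j)"
        using less.prems S_stage_rec[OF w, of H i] by auto
      have "bracketed (replace_points X Y)"
        using X Y by (intro bracketed_replace_points IH) auto
      thus ?thesis unfolding Z by (rule bracketed_dir_image) (auto intro!: inj_onI)
    qed
  qed
qed

lemma bracketed_S_types:
  fixes H :: "'a rel set"
  assumes "\<And>X. X \<in> H \<Longrightarrow> bracketed X" "X \<in> S_types H"
  shows "bracketed X"
proof -
  obtain Z where Z: "Z \<in> S_union H" "similar X Z"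
    using assms(2) unfolding S_types_def by blast
  obtain w :: "'a nested set rel" and i where "Well_order w" "Z \<in> S_stage H w i"
    using Z(1) unfolding S_union_def by blast
  hence "bracketed Z" using bracketed_S_stage[of H w Z i] assms(1) by blast
  thus ?thesis using Z(2) bracketed_similar by blast
qed

section \<open>Lexicographic powers\<close>

lemma Field_lex_power: "Field (lex_power X a) = Field a \<rightarrow>\<^sub>E Field X"
proof
  show "Field (lex_power X a) \<subseteq> Field a \<rightarrow>\<^sub>E Field X"
    unfolding Field_def[of "lex_power X a"] by (auto simp: lex_power_def)
  show "Field a \<rightarrow>\<^sub>E Field X \<subseteq> Field (lex_power X a)"
  proof
    fix f assume "f \<in> Field a \<rightarrow>\<^sub>E Field X"
    hence "(f, f) \<in> lex_power X a" by (simp add: lex_power_def)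
    thus "f \<in> Field (lex_power X a)" by (rule FieldI1)
  qed
qed

lemma lex_power_total:
  assumes a: "Well_order a" and X: "total_on (Field X) X"
    and fg: "f \<in> Field a \<rightarrow>\<^sub>E Field X" "g \<in> Field a \<rightarrow>\<^sub>E Field X" "f \<noteq> g"
  shows "(f, g) \<in> lex_power X a \<or> (g, f) \<in> lex_power X a"
proof -
  have wf: "wf (a - Id)" using a by (simp add: well_order_on_def)
  define D where "D = {i \<in> Field a. f i \<noteq> g i}"
  have "D \<noteq> {}" using fg PiE_ext[OF fg(1,2)] unfolding D_def by blast
  then obtain i where i: "i \<in> D" and min: "\<And>j. (j, i) \<in> a - Id \<Longrightarrow> j \<notin> D"
    using wfE_min'[OF wf, of D] by metis
  have eq: "\<forall>j\<in>underS a i. f j = g j"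
  proof
    fix j assume "j \<in> underS a i"
    hence "(j, i) \<in> a - Id" "j \<in> Field a" by (auto simp: underS_def Field_def)
    thus "f j = g j" using min[of j] unfolding D_def by blast
  qed
  have "f i \<in> Field X" "g i \<in> Field X" "f i \<noteq> g i" using i fg unfolding D_def by auto
  hence "(f i, g i) \<in> X \<or> (g i, f i) \<in> X" using X unfolding total_on_def by blast
  thus ?thesis using i eq fg unfolding lex_power_def D_def by force
qed

lemma Field_Restr_subset:
  assumes "Well_order a" "B \<subseteq> Field a"
  shows "Field (Restr a B) = B"
  using assms by (intro Refl_Field_Restr2) (auto simp: well_order_on_def linear_order_on_def
    partial_order_on_def preorder_on_def)

text \<open>
  Here \<open>p\<close> maps each index to the number of its block. Monotonicity makes the blocks consecutive,
  so the first difference of two functions lies in the first block on which they differ.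
\<close>

lemma representable_lex_power_blocks:
  fixes p :: "'i \<Rightarrow> nat"
  assumes a: "Well_order a" and X: "total_on (Field X) X"
    and mono: "\<And>i j. (i, j) \<in> a \<Longrightarrow> p i \<le> p j"
    and blocks: "\<And>n. bracketed (lex_power X (Restr a {i \<in> Field a. p i = n}))"
  shows "representable (lex_power X a)"
proof -
  define B where "B n = {i \<in> Field a. p i = n}" for n
  have FB: "Field (Restr a (B n)) = B n" for n
    by (rule Field_Restr_subset[OF a]) (auto simp: B_def)
  obtain N where N: "nesting N" using nesting_exists by blast
  note N_baire = nesting_baire1[OF N] and N_less = nesting_less[OF N]
  have "\<exists>E. (\<forall>f\<in>B n \<rightarrow>\<^sub>E Field X. bracket (E f)) \<and>
      (\<forall>f\<in>B n \<rightarrow>\<^sub>E Field X. \<forall>g\<in>B n \<rightarrow>\<^sub>E Field X.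
        f \<noteq> g \<longrightarrow> (f, g) \<in> lex_power X (Restr a (B n)) \<longrightarrow> snd (E f) < fst (E g))" for n
    using blocks[of n] unfolding bracketed_def B_def[symmetric] Field_lex_power FB by (elim conjE)
  then obtain E where E: "\<And>n f. f \<in> B n \<rightarrow>\<^sub>E Field X \<Longrightarrow> bracket (E n f)"
    "\<And>n f g. f \<in> B n \<rightarrow>\<^sub>E Field X \<Longrightarrow> g \<in> B n \<rightarrow>\<^sub>E Field X \<Longrightarrow> f \<noteq> g \<Longrightarrow>
      (f, g) \<in> lex_power X (Restr a (B n)) \<Longrightarrow> snd (E n f) < fst (E n g)"
    by metis
  have mem: "restrict f (B n) \<in> B n \<rightarrow>\<^sub>E Field X" if "f \<in> Field (lex_power X a)" for f n
    using that unfolding Field_lex_power B_def by auto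
  have br: "bracket (E n (restrict f (B n)))" if "f \<in> Field (lex_power X a)" for f n
    by (rule E(1)[OF mem[OF that]])
  show ?thesis
  proof (rule representableI[of _ "\<lambda>f. N (\<lambda>n. E n (restrict f (B n)))"])
    fix f assume f: "f \<in> Field (lex_power X a)"
    show "(f, f) \<in> lex_power X a" using f unfolding Field_lex_power by (simp add: lex_power_def)
    show "baire1 (N (\<lambda>n. E n (restrict f (B n))))" using br[OF f] by (rule N_baire)
    fix g assume g: "g \<in> Field (lex_power X a)" and ne: "f \<noteq> g"
    show "(f, g) \<in> lex_power X a \<or> (g, f) \<in> lex_power X a"
      using lex_power_total[OF a X _ _ ne] f g unfolding Field_lex_power by blast
    assume "(f, g) \<in> lex_power X a"
    then obtain i where i: "i \<in> Field a" "f i \<noteq> g i" "(f i, g i) \<in> X"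
      and eq: "\<And>j. j \<in> underS a i \<Longrightarrow> f j = g j"
      using ne unfolding lex_power_def by blast
    show "N (\<lambda>n. E n (restrict f (B n))) < N (\<lambda>n. E n (restrict g (B n)))"
    proof (rule N_less[where n = "p i"])
      fix k assume k: "k < p i"
      have "f j = g j" if "j \<in> B k" for j
      proof (rule eq)
        have j: "j \<in> Field a" "p j < p i" using that k by (auto simp: B_def)
        hence "(i, j) \<notin> a" "i \<noteq> j" using mono[of i j] by auto
        moreover have "total_on (Field a) a"
          using a by (simp add: well_order_on_def linear_order_on_def)
        ultimately have "(j, i) \<in> a" using i(1) j(1) unfolding total_on_def by metis
        thus "j \<in> underS a i" using \<open>i \<noteq> j\<close> by (simp add: underS_def)
      qed
      hence "restrict f (B k) = restrict g (B k)" by (rule restrict_ext)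
      thus "E k (restrict f (B k)) = E k (restrict g (B k))" by simp
    next
      have iB: "i \<in> B (p i)" using i(1) by (simp add: B_def)
      have "restrict f (B (p i)) \<noteq> restrict g (B (p i))"
        using iB i(2) by (metis restrict_apply')
      moreover have "\<forall>j\<in>underS (Restr a (B (p i))) i. restrict f (B (p i)) j = restrict g (B (p i)) j"
        using eq by (auto simp: underS_def)
      hence "(restrict f (B (p i)), restrict g (B (p i))) \<in> lex_power X (Restr a (B (p i)))"
        using mem[OF f] mem[OF g] iB i(2,3) unfolding lex_power_def FB
        by (intro CollectI case_prodI conjI disjI2 bexI[of _ i]) (assumption | simp)+
      ultimately show "snd (E (p i) (restrict f (B (p i)))) < fst (E (p i) (restrict g (B (p i))))"
        by (intro E(2) mem f g)
    qed (rule br[OF f], rule br[OF g])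
  qed
qed

lemma bracketed_lex_power_empty: "bracketed (lex_power X {})"
proof -
  have eq: "lex_power X {} = {(\<lambda>_. undefined, \<lambda>_. undefined)}"
    unfolding lex_power_def by auto
  have "\<forall>x\<in>Field (lex_power X {}). bracket (\<lambda>_. 0, \<lambda>_. 1/2)"
    by (auto intro: bracket_const)
  thus ?thesis unfolding bracketed_def eq
    by (intro conjI exI[of _ "\<lambda>_. (\<lambda>_. 0, \<lambda>_. 1/2)"]) (auto simp: Field_def total_on_def)
qed

lemma bracketed_lex_power_singleton:
  assumes X: "bracketed X"
  shows "bracketed (lex_power X {(i, i)})"
proof (rule bracketed_similar[OF _ X])
  have F: "Field {(i, i)} = {i}" by (auto simp: Field_def)
  have ext: "f = g" if "f \<in> {i} \<rightarrow>\<^sub>E Field X" "g \<in> {i} \<rightarrow>\<^sub>E Field X" "f i = g i" for f g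
    by (rule PiE_ext[OF that(1,2)]) (simp add: that(3))
  have "inj_on (\<lambda>f. f i) ({i} \<rightarrow>\<^sub>E Field X)" using ext by (intro inj_onI) blast
  moreover have "(\<lambda>f. f i) ` ({i} \<rightarrow>\<^sub>E Field X) = Field X"
  proof
    show "Field X \<subseteq> (\<lambda>f. f i) ` ({i} \<rightarrow>\<^sub>E Field X)"
    proof
      fix x assume "x \<in> Field X"
      thus "x \<in> (\<lambda>f. f i) ` ({i} \<rightarrow>\<^sub>E Field X)"
        by (intro image_eqI[of _ _ "\<lambda>j\<in>{i}. x"]) auto
    qed
  qed auto
  ultimately have "bij_betw (\<lambda>f. f i) (Field (lex_power X {(i, i)})) (Field X)"
    unfolding Field_lex_power F by (simp add: bij_betw_def)
  moreover have "(f, g) \<in> lex_power X {(i, i)} \<longleftrightarrow> (f i, g i) \<in> X"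
    if fg: "f \<in> {i} \<rightarrow>\<^sub>E Field X" "g \<in> {i} \<rightarrow>\<^sub>E Field X" for f g
  proof (cases "f = g")
    case True
    have "f i \<in> Field X" using fg(1) by auto
    thus ?thesis using True X fg unfolding lex_power_def F bracketed_def by auto
  next
    case False
    hence "f i \<noteq> g i" using ext[OF fg] by blast
    moreover have "underS {(i, i)} i = {}" by (auto simp: underS_def)
    ultimately show ?thesis using False fg unfolding lex_power_def F by auto
  qed
  ultimately show "similar (lex_power X {(i, i)}) X"
    unfolding similar_def by (intro exI[of _ "\<lambda>f. f i"]) (simp add: Field_lex_power F)
qed

lemma representable_lex_power_omega:
  assumes "bracketed X"
  shows "representable (lex_power X natLeq)"
proof (rule representable_lex_power_blocks[where p = id, OF natLeq_Well_order])
  show "bracketed (lex_power X (Restr natLeq {i \<in> Field natLeq. id i = n}))" for n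
  proof -
    have "Restr natLeq {i \<in> Field natLeq. id i = n} = {(n, n)}"
      unfolding Field_natLeq by (auto simp: natLeq_def)
    thus ?thesis using bracketed_lex_power_singleton[OF assms] by simp
  qed
qed (use assms in \<open>auto simp: bracketed_def natLeq_def\<close>)

text \<open>
  To cut a well-order \<open>a\<close> of natural numbers into blocks, let \<open>k i\<close> be the numerically least \<open>n\<close> with
  \<open>i \<le>\<^sub>a n\<close>. This is monotone in \<open>i\<close>, and if \<open>k i = n\<close>, then \<open>i\<close> is \<open>n\<close> or an \<open>a\<close>-predecessor of \<open>n\<close>. Separating
  \<open>n\<close> from its predecessors yields blocks that are singletons or contained in a proper
  initial segment of \<open>a\<close>, with no distinction between successor and limit order types.
\<close>

lemma representable_lex_power_step:
  fixes a :: "nat rel"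
  assumes a: "Well_order a" and X: "bracketed X"
    and below: "\<And>m J. m \<in> Field a \<Longrightarrow> J \<subseteq> underS a m \<Longrightarrow> bracketed (lex_power X (Restr a J))"
  shows "representable (lex_power X a)"
proof -
  have "refl_on (Field a) a"
    using a by (simp add: well_order_on_def linear_order_on_def partial_order_on_def
      preorder_on_def)
  hence refl: "(i, i) \<in> a" if "i \<in> Field a" for i
    using that by (rule refl_onD)
  have trans: "trans a" and antisym: "antisym a"
    using a by (auto simp: well_order_on_def linear_order_on_def partial_order_on_def preorder_on_def)
  define k where "k i = (LEAST n. (i, n) \<in> a)" for i
  have k: "(i, k i) \<in> a" if "i \<in> Field a" for i
    unfolding k_def by (rule LeastI[of "\<lambda>n. (i, n) \<in> a", OF refl[OF that]])
  define p where "p i = 2 * k i + (if i = k i then 1 else 0)" for i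
  show ?thesis
  proof (rule representable_lex_power_blocks[where p = p, OF a])
    show "total_on (Field X) X" using X by (simp add: bracketed_def)
  next
    fix i j assume ij: "(i, j) \<in> a"
    have j: "(j, k j) \<in> a" using ij by (intro k) (rule FieldI2)
    have "k i \<le> k j" unfolding k_def[of i] using transD[OF trans ij j] by (rule Least_le)
    moreover have "j = k j" if "k i = k j" "i = k i"
      using antisymD[OF antisym ij] j that by simp
    ultimately show "p i \<le> p j" unfolding p_def by (cases "k i = k j") auto
  next
    fix n
    let ?B = "{i \<in> Field a. p i = n}"
    show "bracketed (lex_power X (Restr a ?B))"
    proof (cases "?B = {}")
      case True
      hence "Restr a ?B = {}" by blast
      thus ?thesis using bracketed_lex_power_empty by metis
    next
      case False
      then obtain i where i: "i \<in> Field a" "p i = n" by blast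
      show ?thesis
      proof (cases "even n")
        case True
        define m where "m = k i"
        have n: "n = 2 * m" using True i(2) unfolding m_def p_def by (auto split: if_splits)
        have "?B \<subseteq> underS a m"
        proof
          fix j assume j: "j \<in> ?B"
          have "p j = 2 * m" using j n by simp
          hence "k j = m" "j \<noteq> m" unfolding p_def by (auto split: if_splits) presburger+
          thus "j \<in> underS a m" using k[of j] j by (auto simp: underS_def)
        qed
        moreover have "m \<in> Field a" unfolding m_def using k[OF i(1)] by (rule FieldI2)
        ultimately show ?thesis by (intro below)
      next
        case False
        have "?B = {i}"
        proof -
          have *: "n = 2 * j + 1" if "p j = n" for j
            using that False unfolding p_def by (auto split: if_splits)
          show ?thesis using i *[OF i(2)] * by fastforce
        qed
        hence "Restr a ?B = {(i, i)}" using refl[OF i(1)] by auto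
        thus ?thesis using bracketed_lex_power_singleton[OF X, of i] by metis
      qed
    qed
  qed
qed

lemma bracketed_of_representable:
  fixes r :: "'a rel"
  assumes dup: "\<forall>Z :: (real \<Rightarrow> real) rel. representable Z \<longrightarrow> representable (duplication Z)"
    and r: "representable r"
  shows "bracketed r"
proof -
  obtain \<Phi> where \<Phi>: "\<And>x. x \<in> Field r \<Longrightarrow> (x, x) \<in> r"
    "\<And>x y. x \<in> Field r \<Longrightarrow> y \<in> Field r \<Longrightarrow> x \<noteq> y \<Longrightarrow> (x, y) \<in> r \<or> (y, x) \<in> r"
    "\<And>x. x \<in> Field r \<Longrightarrow> baire1 (\<Phi> x)"
    "\<And>x y. x \<in> Field r \<Longrightarrow> y \<in> Field r \<Longrightarrow> x \<noteq> y \<Longrightarrow> (x, y) \<in> r \<Longrightarrow> \<Phi> x < \<Phi> y"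
    using r by (rule representableE) (rule that, assumption+)
  show ?thesis
    by (rule bracketed_duplication[OF representable_duplication_all_types[OF dup r]])
      (use \<Phi>(1,2) in \<open>auto simp: total_on_def\<close>)
qed

text \<open>
  The induction ranges over arbitrary subsets of proper initial segments, not just over the
  segments, because these are the bounded blocks.
\<close>

lemma representable_lex_power:
  fixes a :: "nat rel"
  assumes dup: "\<forall>Z :: (real \<Rightarrow> real) rel. representable Z \<longrightarrow> representable (duplication Z)"
    and a: "Well_order a" and X: "bracketed X"
  shows "representable (lex_power X a)"
proof -
  have wf: "wf (a - Id)" using a by (simp add: well_order_on_def)
  have below: "bracketed (lex_power X (Restr a J))" if "n \<in> Field a" "J \<subseteq> underS a n" for n J
    using wf that
  proof (induction n arbitrary: J rule: wf_induct_rule)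
    case (less n)
    have "J \<subseteq> Field a" using less.prems by (auto simp: underS_def Field_def)
    hence FJ: "Field (Restr a J) = J" by (rule Field_Restr_subset[OF a])
    have "representable (lex_power X (Restr a J))"
    proof (rule representable_lex_power_step[OF _ X])
      show "Well_order (Restr a J)" using a by (rule Well_order_Restr)
      fix m K assume m: "m \<in> Field (Restr a J)" and K: "K \<subseteq> underS (Restr a J) m"
      have "m \<in> underS a n" using m FJ less.prems by blast
      hence "(m, n) \<in> a - Id" "m \<in> Field a" by (auto simp: underS_def Field_def)
      moreover have "K \<subseteq> underS a m" using K by (auto simp: underS_def)
      ultimately have "bracketed (lex_power X (Restr a K))" by (intro less.IH)
      moreover have "Restr (Restr a J) K = Restr a K" using K by (auto simp: underS_def)
      ultimately show "bracketed (lex_power X (Restr (Restr a J) K))" by simp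
    qed
    thus ?case by (rule bracketed_of_representable[OF dup])
  qed
  thus ?thesis by (intro representable_lex_power_step[OF a X])
qed

theorem corollary3p9:
  fixes H :: "'a rel set"
  assumes "\<forall>X\<in>H. Linear_order X"
    and "\<forall>X\<in>H. representable (duplication X)"
  shows "(\<forall>Y\<in>omega_class (S_types H :: 'b rel set). representable Y) \<and>
    ((\<forall>Z :: (real \<Rightarrow> real) rel. representable Z \<longrightarrow> representable (duplication Z)) \<longrightarrow>
      (\<forall>Y\<in>star_class (S_types H :: 'b rel set). representable Y))"
proof (intro conjI impI ballI)
  have H: "bracketed X" if "X \<in> H" for X
    using assms that
    by (intro bracketed_duplication) (auto simp: linear_order_on_def partial_order_on_def
      preorder_on_def refl_on_def)
  have S: "bracketed X" if "X \<in> S_types H" for X :: "'b rel"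
    using H that by (rule bracketed_S_types)
  show "representable Y" if "Y \<in> omega_class (S_types H :: 'b rel set)" for Y
    using that S unfolding omega_class_def
    by (auto intro!: representable_Restr representable_lex_power_omega)
  assume dup: "\<forall>Z :: (real \<Rightarrow> real) rel. representable Z \<longrightarrow> representable (duplication Z)"
  show "representable Y" if "Y \<in> star_class (S_types H :: 'b rel set)" for Y
    using that
  proof (induction rule: star_class.induct)
    case (base X)
    show ?case
      by (rule representable_dir_image[OF bracketed_representable[OF S[OF base]]])
        (simp add: inj_def)
  next
    case (power X a)
    have "representable (lex_power X a)"
      using power by (intro representable_lex_power bracketed_of_representable dup)
    thus ?case by (rule representable_dir_image) (simp add: inj_def)
  qed
qed

end
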